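(* Let $k,l\ge 1$ and let $F\subsetneq\mathbb{C}^k$ and $G\subsetneq\mathbb{C}^l$ be proper closed subsets. Then for any countable set $C$ of points in $\mathbb{C}^{k+l}$ with $\operatorname{dist}(C,F\times G)>0$ there exists a holomorphic immersion $f:\mathbb{C}\to\mathbb{C}^{k+l}$ such that $C\subset f(\mathbb{C})\subset\mathbb{C}^{k+l}\setminus(F\times G)$.
   Context: Here $\mathbb{C}^{k+l}=\mathbb{C}^k\times\mathbb{C}^l$, and $\operatorname{dist}(A,B)=\inf\{|a-b|:a\in A,\,b\in B\}$ (with the infimum over the empty set equal to $+\infty$). A holomorphic immersion $f:\mathbb{C}\to\mathbb{C}^{k+l}$ is a holomorphic map with $f'(z)\ne 0$ for all $z\in\mathbb{C}$ (it need not be injective). Countable means at most countable. *)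

theory Defs
  imports "HOL-Complex_Analysis.Complex_Analysis" "HOL-Library.Extended_Real"
begin

text \<open>
  The space \<open>\<complex>\<^sup>k\<^sup>+\<^sup>l = \<complex>\<^sup>k \<times> \<complex>\<^sup>l\<close> is the type \<open>(complex ^ 'k) \<times> (complex ^ 'l)\<close>, with
  \<open>k = CARD('k) \<ge> 1\<close> and \<open>l = CARD('l) \<ge> 1\<close>; its library norm is the Euclidean one.
\<close>

text \<open>
  The library function \<^const>\<open>setdist\<close> is not used, because it is 0 when one of the sets is
  empty; here the infimum over the empty set is \<open>\<infinity>\<close>.
\<close>

definition set_distance :: "'a::metric_space set \<Rightarrow> 'a set \<Rightarrow> ereal" where
  "set_distance A B = (INF (a, b)\<in>A \<times> B. ereal (dist a b))"

definition holomorphic_map ::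
    "(complex \<Rightarrow> (complex ^ 'k) \<times> (complex ^ 'l)) \<Rightarrow> bool" where
  "holomorphic_map f \<longleftrightarrow>
     (\<forall>i. (\<lambda>z. fst (f z) $ i) holomorphic_on UNIV) \<and>
     (\<forall>j. (\<lambda>z. snd (f z) $ j) holomorphic_on UNIV)"

definition complex_derivative ::
    "(complex \<Rightarrow> (complex ^ 'k) \<times> (complex ^ 'l)) \<Rightarrow> complex \<Rightarrow> (complex ^ 'k) \<times> (complex ^ 'l)"
where
  "complex_derivative f z =
     ((\<chi> i. deriv (\<lambda>w. fst (f w) $ i) z), (\<chi> j. deriv (\<lambda>w. snd (f w) $ j) z))"

definition holomorphic_immersion ::
    "(complex \<Rightarrow> (complex ^ 'k) \<times> (complex ^ 'l)) \<Rightarrow> bool" where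
  "holomorphic_immersion f \<longleftrightarrow>
     holomorphic_map f \<and> (\<forall>z. complex_derivative f z \<noteq> 0)"

end

theory Submission
  imports Defs
begin

text \<open>
  The plane is covered by horizontal bands, centred at the heights \<open>0, 1, 2, \<dots>\<close>: on the even bands
  the first component of \<open>f\<close> stays close to a constant far from \<open>F\<close>, on the odd ones the second
  component stays close to a constant far from \<open>G\<close>. Adjacent bands overlap, so each component jumps
  between its constants inside strips where the other one is controlled. The point \<open>\<i> * m\<close> is sent
  exactly to a point of \<open>C\<close> whose first (\<open>m\<close> even) or second (\<open>m\<close> odd) component is far from \<open>F\<close>
  or \<open>G\<close>.

  The jumps come from an entire function tending to 0 uniformly as \<open>Im z \<rightarrow> -\<infinity>\<close> and to 1 uniformly as
  \<open>Im z \<rightarrow> \<infinity>\<close>. It is a normalised primitive of \<open>L z * L (- z)\<close>, where \<open>L\<close> is the Laplace-type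
  integral of \<open>exp (z t) (1 + t)\<^sup>-\<^sup>t\<close> over \<open>t > 0\<close>, which is entire and bounded by
  \<open>1 / (\<bar>Im z\<bar> - \<pi> / 2)\<close>. Since \<open>L\<close> commutes with conjugation, \<open>L z * L (- z) = \<bar>L z\<bar>\<^sup>2\<close> on the
  imaginary axis, so the primitive has distinct limits and is strictly monotone there; the monotonicity
  makes exact interpolation at the points \<open>\<i> * m\<close> possible by Lagrange polynomials in it.

  For the immersion property, the first components are perturbed so that their derivatives do not
  vanish on the countable zero set of the derivative of one second component.
\<close>

section \<open>Locally uniform series of entire functions\<close>

text \<open>The M-test on each closed disc about 0 gives locally uniform convergence, which carries
  over to derivatives. \<open>N\<close> and \<open>M\<close> may depend on the radius
  \<open>R\<close>, because the series below are controlled only on discs that grow with the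
  index.\<close>

lemma entire_series:
  fixes g :: "nat \<Rightarrow> complex \<Rightarrow> complex"
  assumes hol: "\<And>n. g n holomorphic_on UNIV"
    and bound: "\<And>R. \<exists>N M. summable M \<and> (\<forall>n\<ge>N. \<forall>z. norm z \<le> R \<longrightarrow> norm (g n z) \<le> M n)"
  shows "(\<lambda>z. \<Sum>n. g n z) holomorphic_on UNIV"
    and "summable (\<lambda>n. g n z)"
    and "(\<lambda>n. deriv (g n) z) sums deriv (\<lambda>z. \<Sum>n. g n z) z"
proof -
  have unif: "uniform_limit (cball 0 R) (\<lambda>n x. \<Sum>i<n. g i x) (\<lambda>z. \<Sum>n. g n z) sequentially" for R
  proof -
    obtain N M where "summable M" and M: "\<forall>n\<ge>N. \<forall>z. norm z \<le> R \<longrightarrow> norm (g n z) \<le> M n"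
      using bound by blast
    show ?thesis
      by (rule Weierstrass_m_test_ev[OF _ \<open>summable M\<close>])
        (use M in \<open>auto simp: eventually_sequentially intro!: exI[of _ N]\<close>)
  qed
  have loc: "\<exists>d. 0 < d \<and> cball x d \<subseteq> UNIV \<and>
      uniform_limit (cball x d) (\<lambda>n x. \<Sum>i<n. g i x) (\<lambda>z. \<Sum>n. g n z) sequentially" for x
    by (rule exI[of _ 1], intro conjI uniform_limit_on_subset[OF unif[of "norm x + 1"]])
      (auto simp: cball_subset_cball_iff)
  show hol': "(\<lambda>z. \<Sum>n. g n z) holomorphic_on UNIV"
    by (rule holomorphic_uniform_sequence[OF open_UNIV _ loc]) (auto intro!: holomorphic_intros hol)
  show "summable (\<lambda>n. g n z)"
  proof -
    have "(\<lambda>n. \<Sum>i<n. g i z) \<longlonglongrightarrow> (\<Sum>n. g n z)"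
      by (rule tendsto_uniform_limitI[OF unif[of "norm z"]]) auto
    thus ?thesis by (auto simp: summable_def sums_def)
  qed
  have "((\<lambda>x. \<Sum>i<n. g i x) has_field_derivative (\<Sum>i<n. deriv (g i) x)) (at x)" for n x
    using hol by (intro DERIV_sum) (auto intro: holomorphic_derivI)
  from has_complex_derivative_uniform_sequence[OF open_UNIV this loc]
  obtain g' where g': "\<And>x. ((\<lambda>z. \<Sum>n. g n z) has_field_derivative g' x) (at x)"
      "\<And>x. (\<lambda>n. \<Sum>i<n. deriv (g i) x) \<longlonglongrightarrow> g' x"
    by auto
  thus "(\<lambda>n. deriv (g n) z) sums deriv (\<lambda>z. \<Sum>n. g n z) z"
    using DERIV_imp_deriv[OF g'(1)[of z]] by (simp add: sums_def)
qed

section \<open>The kernel and its Laplace-type integral\<close>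

text \<open>The variable \<open>t\<close> is complex so that the contour can be moved. The shift in
  \<open>1 + t\<close> puts the branch point at -1, away from the closed right half-plane that
  contains all contours.\<close>

definition kern :: "complex \<Rightarrow> complex \<Rightarrow> complex" where
  "kern z t = exp (z * t - t * Ln (1 + t))"

lemma kern_holomorphic: "kern z holomorphic_on {t. Re t > -1}"
  unfolding kern_def by (intro holomorphic_intros) (auto simp: complex_nonpos_Reals_iff)

text \<open>The exponent is \<open>t * (z - Ln (1 + t))\<close>. In the first quadrant the first
  term of its real part is made negative by the growth of \<open>ln (norm (1 + t))\<close>, the
  second by \<open>Im z\<close> exceeding the argument of \<open>1 + t\<close>.\<close>

lemma norm_kern:
  assumes "Re t \<ge> 0"
  shows "norm (kern z t) =
    exp (Re t * (Re z - ln (norm (1 + t))) - Im t * (Im z - Im (Ln (1 + t))))"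
proof -
  have "1 + t \<noteq> 0" using assms by (auto simp: complex_eq_iff)
  thus ?thesis by (simp add: kern_def algebra_simps)
qed

lemma kern_cnj:
  assumes "Re t \<ge> 0"
  shows "kern (cnj z) (cnj t) = cnj (kern z t)"
proof -
  have "1 + t \<notin> \<real>\<^sub>\<le>\<^sub>0" using assms by (auto simp: complex_nonpos_Reals_iff)
  from cnj_Ln[OF this] show ?thesis by (simp add: kern_def exp_cnj)
qed

text \<open>Cutting the half-line into unit segments turns the improper integral into a series of
  entire functions; contour integrals keep Cauchy's theorem at hand.\<close>

definition kern_piece :: "nat \<Rightarrow> complex \<Rightarrow> complex" where
  "kern_piece n z = contour_integral (linepath (of_nat n) (of_nat (Suc n))) (kern z)"

definition kern_transform :: "complex \<Rightarrow> complex" where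
  "kern_transform z = (\<Sum>n. kern_piece n z)"

lemma segment_Re_ge:
  assumes "Re a \<ge> c" "Re b \<ge> c" "t \<in> closed_segment a b"
  shows "Re t \<ge> c"
proof -
  have "closed_segment a b \<subseteq> {z. c \<le> Re z}"
    by (rule closed_segment_subset) (use assms in \<open>auto simp: convex_halfspace_Re_ge\<close>)
  thus ?thesis using assms by auto
qed

lemma kern_continuous_segment:
  assumes "Re a \<ge> 0" "Re b \<ge> 0"
  shows "continuous_on (closed_segment a b) (kern z)"
proof (rule continuous_on_subset[OF holomorphic_on_imp_continuous_on[OF kern_holomorphic]])
  show "closed_segment a b \<subseteq> {t. - 1 < Re t}"
    using segment_Re_ge[OF assms] by force
qed

lemma kern_piece_integral:
  "kern_piece n z = integral (cbox 0 1) (\<lambda>x. kern z (of_real (real n + x)))"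
proof -
  have *: "linepath (of_nat n) (of_nat (Suc n)) x = complex_of_real (real n + x)" for x
    by (simp add: linepath_def scaleR_conv_of_real algebra_simps)
  show ?thesis
    unfolding kern_piece_def contour_integral_integral
    by (simp add: * del: of_nat_Suc) simp
qed

lemma kern_piece_holomorphic: "kern_piece n holomorphic_on UNIV"
proof -
  have nz: "1 + complex_of_real (real n + x) \<notin> \<real>\<^sub>\<le>\<^sub>0" if "x \<in> cbox 0 1" for x
    using that by (auto simp: complex_nonpos_Reals_iff)
  have "(\<lambda>z. integral (cbox 0 1) (\<lambda>x. kern z (of_real (real n + x)))) holomorphic_on UNIV"
  proof (rule leibniz_rule_holomorphic[where fx = "\<lambda>z x. kern z (of_real (real n + x)) * of_real (real n + x)"])
    show "((\<lambda>z. kern z (of_real (real n + x))) has_field_derivative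
        kern z (of_real (real n + x)) * of_real (real n + x)) (at z within UNIV)" for z x
      unfolding kern_def by (auto intro!: derivative_eq_intros)
    show "(\<lambda>x. kern z (of_real (real n + x))) integrable_on cbox 0 1" for z
      unfolding kern_def using nz by (intro integrable_continuous continuous_intros) auto
    show "continuous_on (UNIV \<times> cbox 0 1)
        (\<lambda>(z, x). kern z (of_real (real n + x)) * of_real (real n + x))"
      unfolding kern_def split_def by (intro continuous_intros) (use nz in auto)
  qed auto
  thus ?thesis by (simp add: kern_piece_integral[abs_def] del: cbox_interval)
qed

text \<open>For \<open>n\<close> this large the factor \<open>Re z - ln (norm (1 + t))\<close> is at
  most -1 on the segment, where also \<open>Re t \<ge> n\<close>.\<close>

lemma norm_kern_piece_le:
  assumes "norm z \<le> K" "exp (K + 1) \<le> real n"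
  shows "norm (kern_piece n z) \<le> exp (-1) ^ n"
proof -
  have "norm (kern z t) \<le> exp (-1) ^ n" if "t \<in> closed_segment (of_nat n) (of_nat (Suc n))" for t
  proof -
    from that obtain x where x: "0 \<le> x" "x \<le> 1" "t = of_real (real n + x)"
      by (auto simp: closed_segment_def scaleR_conv_of_real algebra_simps)
    have im: "Im t = 0" "Re t = real n + x" "Re t \<ge> 0" using x by auto
    have "ln (norm (1 + t)) \<ge> ln (exp (K + 1))"
    proof (rule ln_mono)
      have "norm (1 + t) \<ge> Re (1 + t)" by (rule complex_Re_le_cmod)
      thus "exp (K + 1) \<le> norm (1 + t)" using assms(2) im x by simp
    qed auto
    hence "Re z - ln (norm (1 + t)) \<le> -1"
      using complex_Re_le_cmod[of z] assms(1) by simp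
    hence "(Re t) * (Re z - ln (norm (1 + t))) \<le> (Re t) * (-1)"
      using im(3) by (rule mult_left_mono)
    hence "norm (kern z t) \<le> exp (- real n)"
      using im x by (subst norm_kern) auto
    thus ?thesis by (simp add: exp_of_nat_mult[symmetric])
  qed
  moreover have "kern z contour_integrable_on linepath (of_nat n) (of_nat (Suc n))"
    by (intro contour_integrable_continuous_linepath kern_continuous_segment) auto
  ultimately have "norm (kern_piece n z) \<le> exp (-1) ^ n * norm (of_nat (Suc n) - of_nat n :: complex)"
    unfolding kern_piece_def by (intro contour_integral_bound_linepath) auto
  thus ?thesis by simp
qed

lemma kern_piece_bound:
  "\<exists>N M. summable M \<and> (\<forall>n\<ge>N. \<forall>z. norm z \<le> R \<longrightarrow> norm (kern_piece n z) \<le> M n)"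
proof -
  obtain N where N: "exp (R + 1) \<le> real N" using real_arch_simple by blast
  have "norm (kern_piece n z) \<le> exp (-1) ^ n" if "n \<ge> N" "norm z \<le> R" for n z
    using norm_kern_piece_le[of z R n] N that by (meson of_nat_le_iff order_trans)
  moreover have "summable (\<lambda>n. exp (-1::real) ^ n)" by (rule summable_geometric) simp
  ultimately show ?thesis by blast
qed

lemma kern_transform_holomorphic: "kern_transform holomorphic_on UNIV"
  unfolding kern_transform_def[abs_def]
  by (rule entire_series(1)[OF kern_piece_holomorphic kern_piece_bound])

lemma kern_piece_sums: "(\<lambda>n. kern_piece n z) sums kern_transform z"
  unfolding kern_transform_def
  by (rule summable_sums, rule entire_series(2)[OF kern_piece_holomorphic kern_piece_bound])

lemma kern_piece_cnj: "kern_piece n (cnj z) = cnj (kern_piece n z)"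
proof -
  have "integral (cbox 0 1) (\<lambda>x. kern (cnj z) (of_real (real n + x)))
      = integral (cbox 0 1) (\<lambda>x. cnj (kern z (of_real (real n + x))))"
  proof (rule integral_cong)
    fix x :: real assume "x \<in> cbox 0 1"
    thus "kern (cnj z) (of_real (real n + x)) = cnj (kern z (of_real (real n + x)))"
      using kern_cnj[of "of_real (real n + x)" z] by simp
  qed
  thus ?thesis by (simp add: kern_piece_integral integral_cnj)
qed

lemma kern_transform_cnj: "kern_transform (cnj z) = cnj (kern_transform z)"
proof -
  have "(\<lambda>n. kern_piece n (cnj z)) sums cnj (kern_transform z)"
    using kern_piece_sums[of z] by (simp add: kern_piece_cnj sums_cnj)
  thus ?thesis using kern_piece_sums sums_unique2 by blast
qed

lemma kern_0_of_real:
  assumes "y \<ge> 0"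
  shows "kern 0 (of_real y) = of_real (exp (- y * ln (1 + y)))"
proof -
  have "Ln (complex_of_real (1 + y)) = of_real (ln (1 + y))"
    using assms by (intro Ln_of_real) auto
  thus ?thesis by (simp add: kern_def exp_of_real[symmetric])
qed

text \<open>For \<open>z = 0\<close> the integrand is positive on the half-line, so a positive lower
  bound for the first piece suffices. This excludes that the transform vanishes identically.\<close>

lemma kern_transform_0: "kern_transform 0 \<noteq> 0"
proof -
  define k where "k = (\<lambda>(n::nat) (x::real). exp (- (real n + x) * ln (1 + (real n + x))))"
  have cont: "continuous_on (cbox 0 1) (k n)" for n
    unfolding k_def by (intro continuous_intros) auto
  have eq: "kern_piece n 0 = of_real (integral (cbox 0 1) (k n))" for n
  proof -
    have "integral (cbox 0 1) (\<lambda>x. kern 0 (of_real (real n + x)))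
        = integral (cbox 0 1) (\<lambda>x. complex_of_real (k n x))"
    proof (rule integral_cong)
      fix x :: real assume "x \<in> cbox 0 1"
      thus "kern 0 (of_real (real n + x)) = of_real (k n x)"
        using kern_0_of_real[of "real n + x"] by (simp add: k_def del: of_real_add)
    qed
    also have "\<dots> = of_real (integral (cbox 0 1) (k n))"
      using integral_linear[OF integrable_continuous[OF cont] bounded_linear_of_real]
      by (simp add: o_def)
    finally show ?thesis by (simp add: kern_piece_integral)
  qed
  have nonneg: "integral (cbox 0 1) (k n) \<ge> 0" for n
    by (rule integral_nonneg[OF integrable_continuous[OF cont]]) (auto simp: k_def)
  have pos: "integral (cbox 0 1) (k 0) > 0"
  proof -
    have "integral (cbox 0 1) (\<lambda>x::real. exp (- ln 2) :: real) \<le> integral (cbox 0 1) (k 0)"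
    proof (rule integral_le)
      fix x :: real assume x: "x \<in> cbox 0 1"
      have "x * ln (1 + x) \<le> 1 * ln 2"
        using x by (intro mult_mono) auto
      thus "exp (- ln 2) \<le> k 0 x" by (simp add: k_def)
    qed (use integrable_continuous[OF cont] in auto)
    thus ?thesis by (simp add: exp_minus)
  qed
  have "(\<lambda>n. Re (kern_piece n 0)) sums Re (kern_transform 0)"
    using kern_piece_sums by (rule sums_Re)
  hence s: "(\<lambda>n. integral (cbox 0 1) (k n)) sums Re (kern_transform 0)" by (simp add: eq)
  have "0 < suminf (\<lambda>n. integral (cbox 0 1) (k n))"
    by (rule suminf_pos2[OF sums_summable[OF s] nonneg pos])
  thus ?thesis using s by (auto simp: sums_iff)
qed

section \<open>Decay of the integral away from the real axis\<close>

lemma kern_piece_sum: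
  "(\<Sum>k<n. kern_piece k z) = contour_integral (linepath 0 (of_nat n)) (kern z)"
proof (induction n)
  case (Suc n)
  have "complex_of_nat n \<in> closed_segment 0 (of_nat (Suc n))"
    unfolding closed_segment_def mem_Collect_eq
    by (rule exI[of _ "real n / real (Suc n)"])
      (simp add: scaleR_conv_of_real divide_simps del: of_nat_Suc)
  from contour_integral_split_linepath[OF kern_continuous_segment this, of z] Suc
  show ?case by (simp add: kern_piece_def del: of_nat_Suc linepath_0)
qed (metis contour_integral_trivial lessThan_0 of_nat_0 sum.empty)

text \<open>The contour is rotated from the positive real axis to the positive imaginary one, where the
  kernel decays as soon as the imaginary part of the argument exceeds \<open>pi / 2\<close>.\<close>

lemma norm_kern_quadrant:
  assumes t: "Re t \<ge> 0" "Im t \<ge> 0"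
    and c: "Im z \<ge> pi / 2 + c" and r: "Re t = 0 \<or> Re z + c \<le> ln (norm (1 + t))"
  shows "norm (kern z t) \<le> exp (- c * (Re t + Im t))"
proof -
  have "1 + t \<noteq> 0" using t by (auto simp: complex_eq_iff)
  moreover have "Re (1 + t) \<ge> 0" using t by simp
  ultimately have "Im (Ln (1 + t)) \<le> pi / 2"
    using Re_Ln_pos_le[of "1 + t"] by linarith
  hence "Im t * c \<le> Im t * (Im z - Im (Ln (1 + t)))"
    using t c by (intro mult_left_mono) auto
  \<comment> \<open>On the imaginary axis this product is zero, so the bound holds there down to
    \<open>t = 0\<close>, where \<open>ln (norm (1 + t))\<close> is small.\<close>
  moreover have "Re t * (Re z - ln (norm (1 + t))) \<le> Re t * (- c)"
  proof (cases "Re t = 0")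
    case False
    thus ?thesis using t r by (intro mult_left_mono) auto
  qed auto
  ultimately show ?thesis using t by (subst norm_kern) (auto simp: algebra_simps)
qed

text \<open>At \<open>\<i> * y\<close> the kernel is at most \<open>exp (- c * y)\<close>, whose
  integral over the whole half-line is \<open>1 / c\<close>; hence the bound is uniform in
  \<open>n\<close>.\<close>

lemma norm_contour_imaginary:
  assumes c: "c > 0" "Im z \<ge> pi / 2 + c"
  shows "norm (contour_integral (linepath 0 (\<i> * of_nat n)) (kern z)) \<le> 1 / c"
proof (cases "n = 0")
  case False
  have I: "((\<lambda>x. real n * exp (- c * (real n * x))) has_integral
      (- exp (- c * (real n * 1)) / c) - (- exp (- c * (real n * 0)) / c)) {0..1}"
  proof (rule fundamental_theorem_of_calculus)
    fix x :: real
    show "((\<lambda>x. - exp (- c * (real n * x)) / c) has_vector_derivative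
        real n * exp (- c * (real n * x))) (at x within {0..1})"
      using c unfolding has_real_derivative_iff_has_vector_derivative[symmetric]
      by (auto intro!: derivative_eq_intros)
  qed auto
  have "norm (contour_integral (linepath 0 (\<i> * of_nat n)) (kern z))
      = norm (integral {0..1} (\<lambda>x. kern z (linepath 0 (\<i> * of_nat n) x) * (\<i> * of_nat n)))"
    by (simp add: contour_integral_integral)
  also have "\<dots> \<le> integral {0..1} (\<lambda>x. real n * exp (- c * (real n * x)))"
  proof (rule integral_norm_bound_integral)
    show "(\<lambda>x. kern z (linepath 0 (\<i> * of_nat n) x) * (\<i> * of_nat n)) integrable_on {0..1}"
      using contour_integrable_continuous_linepath[OF kern_continuous_segment[of 0 "\<i> * of_nat n" z]]
      by (simp add: contour_integrable_on)
    show "(\<lambda>x. real n * exp (- c * (real n * x))) integrable_on {0..1}"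
      using I by blast
    fix x :: real assume x: "x \<in> {0..1}"
    have "norm (kern z (linepath 0 (\<i> * of_nat n) x)) \<le> exp (- c * (real n * x))"
      using norm_kern_quadrant[of "linepath 0 (\<i> * of_nat n) x" c z] x c
      by (simp add: linepath_def mult.commute)
    thus "norm (kern z (linepath 0 (\<i> * of_nat n) x) * (\<i> * of_nat n))
        \<le> real n * exp (- c * (real n * x))"
      by (simp add: norm_mult mult.commute mult_left_mono)
  qed
  also have "\<dots> = 1 / c - exp (- c * real n) / c"
    using I by (simp add: has_integral_iff)
  also have "\<dots> \<le> 1 / c" using c by simp
  finally show ?thesis .
qed (use c in auto)

text \<open>The decay is governed by \<open>Re t + Im t\<close>, which is constantly
  \<open>n\<close> on this segment, so a straight side serves in place of an arc. One of
  \<open>Re t\<close>, \<open>Im t\<close> is at least \<open>n / 2\<close>, which supplies the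
  logarithmic growth.\<close>

lemma norm_contour_hypotenuse:
  assumes c: "c > 0" "Im z \<ge> pi / 2 + c" and n: "exp (Re z + c) \<le> real n / 2"
  shows "norm (contour_integral (linepath (of_nat n) (\<i> * of_nat n)) (kern z))
    \<le> exp (- c * real n) * (2 * real n)"
proof -
  have "norm (contour_integral (linepath (of_nat n) (\<i> * of_nat n)) (kern z))
      \<le> exp (- c * real n) * norm (\<i> * of_nat n - of_nat n)"
  proof (rule contour_integral_bound_linepath)
    show "kern z contour_integrable_on linepath (of_nat n) (\<i> * of_nat n)"
      by (intro contour_integrable_continuous_linepath kern_continuous_segment) auto
    fix t assume "t \<in> closed_segment (complex_of_nat n) (\<i> * of_nat n)"
    then obtain x where x: "0 \<le> x" "x \<le> 1" and
        t: "t = (1 - x) *\<^sub>R of_nat n + x *\<^sub>R (\<i> * of_nat n)"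
      by (auto simp: closed_segment_def)
    have re: "Re t = (1 - x) * real n" and im: "Im t = x * real n" by (simp_all add: t)
    have "real n / 2 \<le> norm (1 + t)"
    proof (cases "x \<le> 1 / 2")
      case True
      hence "1 / 2 * real n \<le> (1 - x) * real n" by (intro mult_right_mono) auto
      thus ?thesis using complex_Re_le_cmod[of "1 + t"] re by simp
    next
      case False
      hence "1 / 2 * real n \<le> x * real n" by (intro mult_right_mono) auto
      thus ?thesis using abs_Im_le_cmod[of "1 + t"] im by simp
    qed
    hence "exp (Re z + c) \<le> norm (1 + t)" using n by simp
    hence "Re z + c \<le> ln (norm (1 + t))"
      by (metis exp_gt_zero ln_exp ln_mono order_less_le_trans)
    moreover have "Re t \<ge> 0" "Im t \<ge> 0" using x re im by auto
    ultimately have "norm (kern z t) \<le> exp (- c * (Re t + Im t))"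
      using c by (intro norm_kern_quadrant) auto
    thus "norm (kern z t) \<le> exp (- c * real n)" by (simp add: re im algebra_simps)
  qed auto
  also have "norm (\<i> * of_nat n - of_nat n :: complex) \<le> 2 * real n"
    using norm_triangle_ineq4[of "\<i> * of_nat n" "of_nat n :: complex"] by (simp add: norm_mult)
  finally show ?thesis by (simp add: mult_left_mono)
qed

text \<open>Cauchy's theorem on the triangle with vertices 0, \<open>n\<close>,
  \<open>\<i> * n\<close> replaces the real side by the imaginary one; the hypotenuse contributes
  nothing in the limit.\<close>

lemma norm_kern_transform_le_upper:
  assumes c: "c > 0" "Im z \<ge> pi / 2 + c"
  shows "norm (kern_transform z) \<le> 1 / c"
proof (rule LIMSEQ_le)
  have "(\<lambda>n. norm (\<Sum>k<n. kern_piece k z)) \<longlonglongrightarrow> norm (kern_transform z)"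
    using kern_piece_sums[of z] unfolding sums_def by (rule tendsto_norm)
  thus "(\<lambda>n. norm (contour_integral (linepath 0 (of_nat n)) (kern z))) \<longlonglongrightarrow> norm (kern_transform z)"
    by (simp add: kern_piece_sum)
  have "(\<lambda>n. 1 / c + exp (- c * real n) * (2 * real n)) \<longlonglongrightarrow> 1 / c + 0"
    by (intro tendsto_add tendsto_const) (use c in real_asymp)
  thus "(\<lambda>n. 1 / c + exp (- c * real n) * (2 * real n)) \<longlonglongrightarrow> 1 / c" by simp
  obtain N where "2 * exp (Re z + c) \<le> real N"
    using real_arch_simple by blast
  hence N: "exp (Re z + c) \<le> real N / 2" by simp
  have "norm (contour_integral (linepath 0 (of_nat n)) (kern z))
      \<le> 1 / c + exp (- c * real n) * (2 * real n)" if "n \<ge> N" for n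
  proof -
    have n: "exp (Re z + c) \<le> real n / 2" using N that by linarith
    let ?I = "\<lambda>a b. contour_integral (linepath a b) (kern z)"
    have sub: "convex hull {0, complex_of_nat n, \<i> * of_nat n} \<subseteq> {t. Re t > -1}"
      by (rule hull_minimal) (auto simp: convex_halfspace_Re_gt)
    have int: "kern z contour_integrable_on linepath a b" if "Re a \<ge> 0" "Re b \<ge> 0" for a b
      using that by (intro contour_integrable_continuous_linepath kern_continuous_segment)
    have "(kern z has_contour_integral 0) (linepath 0 (of_nat n) +++
        linepath (of_nat n) (\<i> * of_nat n) +++ linepath (\<i> * of_nat n) 0)"
      by (rule Cauchy_theorem_triangle[OF holomorphic_on_subset[OF kern_holomorphic sub]])
    moreover have "(kern z has_contour_integral
        (?I 0 (of_nat n) + (?I (of_nat n) (\<i> * of_nat n) + ?I (\<i> * of_nat n) 0)))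
        (linepath 0 (of_nat n) +++ linepath (of_nat n) (\<i> * of_nat n) +++ linepath (\<i> * of_nat n) 0)"
      by (intro has_contour_integral_join has_contour_integral_integral int valid_path_join
            valid_path_linepath) auto
    ultimately have "?I 0 (of_nat n) + (?I (of_nat n) (\<i> * of_nat n) + ?I (\<i> * of_nat n) 0) = 0"
      by (metis has_contour_integral_unique)
    moreover have "?I (\<i> * of_nat n) 0 = - ?I 0 (\<i> * of_nat n)"
      by (rule contour_integral_reverse_linepath) (intro kern_continuous_segment, auto)
    ultimately have "?I 0 (of_nat n) = ?I 0 (\<i> * of_nat n) - ?I (of_nat n) (\<i> * of_nat n)"
      by algebra
    hence "norm (?I 0 (of_nat n)) \<le> norm (?I 0 (\<i> * of_nat n)) + norm (?I (of_nat n) (\<i> * of_nat n))"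
      by (metis norm_triangle_ineq4)
    thus ?thesis
      using norm_contour_imaginary[OF c, of n] norm_contour_hypotenuse[OF c n] by linarith
  qed
  thus "\<exists>N. \<forall>n\<ge>N. norm (contour_integral (linepath 0 (of_nat n)) (kern z))
      \<le> 1 / c + exp (- c * real n) * (2 * real n)" by blast
qed

lemma norm_kern_transform_le:
  assumes "\<bar>Im z\<bar> > pi / 2"
  shows "norm (kern_transform z) \<le> 1 / (\<bar>Im z\<bar> - pi / 2)"
proof (cases "Im z \<ge> 0")
  case True
  thus ?thesis using assms norm_kern_transform_le_upper[of "\<bar>Im z\<bar> - pi / 2" z] by simp
next
  case False
  have "norm (kern_transform z) = norm (kern_transform (cnj z))"
    by (simp add: kern_transform_cnj)
  thus ?thesis using assms False norm_kern_transform_le_upper[of "\<bar>Im z\<bar> - pi / 2" "cnj z"] by simp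
qed

section \<open>The entire step function\<close>

text \<open>Integrating the bound upwards from height \<open>a\<close> gives at most
  \<open>1 / (a - c)\<close>, so limits along vertical lines exist. A horizontal move by
  \<open>x\<close> at height \<open>y\<close> costs at most
  \<open>\<bar>x\<bar> / (y - c)^2\<close>, which tends to 0, so all vertical lines share the limit
  \<open>L\<close>.\<close>

lemma uniform_limit_of_inverse_square_derivative:
  fixes S \<kappa> :: "complex \<Rightarrow> complex"
  assumes deriv: "\<And>z. (S has_field_derivative \<kappa> z) (at z)"
    and bound: "\<And>z. Im z > c \<Longrightarrow> norm (\<kappa> z) \<le> 1 / (Im z - c)\<^sup>2"
    and S0: "\<And>y. Re (S (\<i> * of_real y)) = 0"
  obtains L where "\<And>z. Im z > c \<Longrightarrow> norm (S z - L) \<le> 1 / (Im z - c)"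
    and "(\<lambda>n. S (\<i> * of_nat n)) \<longlonglongrightarrow> L"
proof -
  have vert: "norm (S (Complex x b) - S (Complex x a)) \<le> 1 / (a - c)" if "c < a" "a \<le> b" for x a b
  proof (cases "a < b")
    case True
    have "norm (S (Complex x b) - S (Complex x a)) \<le> - 1 / (b - c) - (- 1 / (a - c))"
    proof (rule differentiable_bound_general[OF True])
      show "continuous_on {a..b} (\<lambda>y. - 1 / (y - c))"
        using that by (intro continuous_intros) auto
      have *: "((\<lambda>y. S (Complex x y)) has_vector_derivative \<kappa> (Complex x y) * \<i>) (at y)" for y
      proof -
        have "((\<lambda>y. Complex x y) has_vector_derivative \<i>) (at y)"
          unfolding Complex_eq by (auto intro!: derivative_eq_intros)
        from field_vector_diff_chain_at[OF this deriv] show ?thesis by (simp add: o_def mult.commute)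
      qed
      thus "((\<lambda>y. S (Complex x y)) has_vector_derivative \<kappa> (Complex x y) * \<i>) (at y)" for y .
      show "continuous_on {a..b} (\<lambda>y. S (Complex x y))"
        using * by (meson continuous_at_imp_continuous_on has_vector_derivative_continuous)
      show "((\<lambda>y. - 1 / (y - c)) has_vector_derivative 1 / (y - c)\<^sup>2) (at y)"
        if "a < y" "y < b" for y
        using that \<open>c < a\<close> unfolding has_real_derivative_iff_has_vector_derivative[symmetric]
        by (auto intro!: derivative_eq_intros simp: power2_eq_square)
      show "norm (\<kappa> (Complex x y) * \<i>) \<le> 1 / (y - c)\<^sup>2" if "a < y" "y < b" for y
        using bound[of "Complex x y"] that \<open>c < a\<close> by (simp add: norm_mult)
    qed
    also have "\<dots> \<le> 1 / (a - c)" using that by simp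
    finally show ?thesis .
  qed (use that in auto)
  have horiz: "norm (S (Complex x y) - S (Complex 0 y)) \<le> 1 / (y - c)\<^sup>2 * \<bar>x\<bar>" if "y > c" for x y
  proof -
    have "norm (S (Complex x y) - S (Complex 0 y)) \<le> 1 / (y - c)\<^sup>2 * norm (Complex x y - Complex 0 y)"
    proof (rule field_differentiable_bound)
      show "convex (closed_segment (Complex 0 y) (Complex x y))" by simp
      show "(S has_field_derivative \<kappa> z) (at z within closed_segment (Complex 0 y) (Complex x y))" for z
        by (rule has_field_derivative_at_within[OF deriv])
      fix z assume "z \<in> closed_segment (Complex 0 y) (Complex x y)"
      hence "Im z = y" using closed_segment_same_Im[of "Complex 0 y" "Complex x y"] by auto
      thus "norm (\<kappa> z) \<le> 1 / (y - c)\<^sup>2" using bound[of z] that by auto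
    qed auto
    also have "norm (Complex x y - Complex 0 y) = \<bar>x\<bar>" by (simp add: cmod_def)
    finally show ?thesis .
  qed
  have ii: "\<i> * of_nat n = Complex 0 (real n)" for n by (simp add: complex_eq_iff)
  have "Cauchy (\<lambda>n. S (\<i> * of_nat n))"
  proof (rule metric_CauchyI)
    fix e :: real assume "e > 0"
    obtain N where N: "real N > c + 2 / e" using reals_Archimedean2 by blast
    have lt: "1 / (real n - c) < e" if "n \<ge> N" for n
    proof -
      have p: "0 < 2 / e" "2 / e < real n - c" using N that \<open>e > 0\<close> by auto
      have "1 / (real n - c) < 1 / (2 / e)"
        by (intro divide_strict_left_mono mult_pos_pos) (use p in linarith)+
      also have "\<dots> \<le> e" using \<open>e > 0\<close> by simp
      finally show ?thesis .
    qed
    have gt: "c < real n" if "n \<ge> N" for n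
    proof -
      have "0 < 2 / e" using \<open>e > 0\<close> by simp
      thus ?thesis using N that by (smt (verit) of_nat_le_iff)
    qed
    have main: "dist (S (\<i> * of_nat n)) (S (\<i> * of_nat m)) < e" if "m \<ge> N" "n \<ge> m" for m n
      using vert[of "real m" "real n" 0] lt[of m] gt[of m] that by (simp add: dist_norm ii)
    show "\<exists>M. \<forall>m\<ge>M. \<forall>n\<ge>M. dist (S (\<i> * of_nat m)) (S (\<i> * of_nat n)) < e"
      using main by (metis dist_commute nat_le_linear)
  qed
  then obtain L where L: "(\<lambda>n. S (\<i> * of_nat n)) \<longlonglongrightarrow> L"
    using Cauchy_convergent convergent_def by blast
  have "norm (S z - L) \<le> 1 / (Im z - c)" if z: "Im z > c" for z
  proof (rule LIMSEQ_le_const)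
    have "(\<lambda>n. 1 / (Im z - c) + (1 / (real n - c)\<^sup>2 * \<bar>Re z\<bar> + norm (S (\<i> * of_nat n) - L)))
        \<longlonglongrightarrow> 1 / (Im z - c) + (0 + norm (L - L))"
      by (intro tendsto_add tendsto_const tendsto_norm tendsto_diff L) real_asymp
    thus "(\<lambda>n. 1 / (Im z - c) + (1 / (real n - c)\<^sup>2 * \<bar>Re z\<bar> + norm (S (\<i> * of_nat n) - L)))
        \<longlonglongrightarrow> 1 / (Im z - c)" by simp
    obtain N where N: "real N > Im z" using reals_Archimedean2 by blast
    have "norm (S z - L) \<le>
        1 / (Im z - c) + (1 / (real n - c)\<^sup>2 * \<bar>Re z\<bar> + norm (S (\<i> * of_nat n) - L))"
      if "n \<ge> N" for n
    proof -
      have n: "real n > Im z" using N that by (meson less_le_trans of_nat_le_iff)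
      \<comment> \<open>The route is up from \<open>z\<close> to height \<open>n\<close>, across to
        the imaginary axis, then to \<open>L\<close>; only the cost of the first leg survives as
        \<open>n\<close> grows.\<close>
      have "S z - L = (S (\<i> * of_nat n) - L) + (S (Complex (Re z) (real n)) - S (Complex 0 (real n)))
          - (S (Complex (Re z) (real n)) - S (Complex (Re z) (Im z)))"
        by (simp add: ii)
      hence "norm (S z - L) \<le> norm (S (\<i> * of_nat n) - L)
          + norm (S (Complex (Re z) (real n)) - S (Complex 0 (real n)))
          + norm (S (Complex (Re z) (real n)) - S (Complex (Re z) (Im z)))"
        by (metis (no_types, lifting) norm_triangle_ineq norm_triangle_ineq4 order_trans add_right_mono)
      thus ?thesis
        using vert[of "Im z" "real n" "Re z"] horiz[of "real n" "Re z"] n z by linarith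
    qed
    thus "\<exists>N. \<forall>n\<ge>N. norm (S z - L) \<le>
        1 / (Im z - c) + (1 / (real n - c)\<^sup>2 * \<bar>Re z\<bar> + norm (S (\<i> * of_nat n) - L))" by blast
  qed
  thus ?thesis using L that by blast
qed

text \<open>Since \<open>\<kappa>\<close> is even, its primitive \<open>S\<close> with
  \<open>S 0 = 0\<close> is odd, so the limits above and below are \<open>L\<close> and
  \<open>- L\<close>. The normalisation \<open>(S / L + 1) / 2\<close> turns them into 1 and
  0.\<close>

lemma ex_entire_step:
  obtains \<sigma> :: "complex \<Rightarrow> complex" where
    "\<sigma> holomorphic_on UNIV" and "\<sigma> 0 = 1 / 2"
    and "\<And>a b. a < b \<Longrightarrow> Re (\<sigma> (\<i> * of_real a)) < Re (\<sigma> (\<i> * of_real b))"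
    and "\<And>\<epsilon>. \<epsilon> > 0 \<Longrightarrow> \<exists>R>0. \<forall>z. (Im z \<le> - R \<longrightarrow> norm (\<sigma> z) \<le> \<epsilon>) \<and> (Im z \<ge> R \<longrightarrow> norm (\<sigma> z - 1) \<le> \<epsilon>)"
proof -
  define \<kappa> where "\<kappa> = (\<lambda>z. kern_transform z * kern_transform (- z))"
  have [holomorphic_intros]: "(\<lambda>z. kern_transform (g z)) holomorphic_on A" if "g holomorphic_on A" for g A
    using holomorphic_on_compose[OF that holomorphic_on_subset[OF kern_transform_holomorphic subset_UNIV]]
    by (simp add: o_def)
  have "\<kappa> holomorphic_on UNIV"
    unfolding \<kappa>_def by (intro holomorphic_intros)
  then obtain S0 where S0: "\<And>z. (S0 has_field_derivative \<kappa> z) (at z)"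
    using holomorphic_convex_primitive'[of UNIV \<kappa>] by auto
  define S where "S z = S0 z - S0 0" for z
  have S: "(S has_field_derivative \<kappa> z) (at z)" for z
    unfolding S_def by (auto intro!: derivative_eq_intros S0)
  have [simp]: "S 0 = 0" by (simp add: S_def)
  have odd: "S (- z) = - S z" for z
  proof -
    have "((\<lambda>z. S (- z) + S z) has_field_derivative 0) (at z)" for z
    proof -
      have "((\<lambda>z. S (- z)) has_field_derivative \<kappa> (- z) * (- 1)) (at z)"
        by (rule DERIV_chain2[OF S]) (auto intro!: derivative_eq_intros)
      from DERIV_add[OF this S[of z]] show ?thesis by (simp add: \<kappa>_def)
    qed
    then obtain c where c: "\<And>z. S (- z) + S z = c"
      using has_field_derivative_zero_constant[of UNIV "\<lambda>z. S (- z) + S z"] by auto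
    from c[of z] c[of 0] show ?thesis by (simp add: add_eq_0_iff)
  qed
  have \<kappa>_im: "\<kappa> (\<i> * of_real y) = of_real ((norm (kern_transform (\<i> * of_real y)))\<^sup>2)" for y
  proof -
    have "- (\<i> * of_real y) = cnj (\<i> * of_real y)" by simp
    thus ?thesis unfolding \<kappa>_def by (metis complex_norm_square kern_transform_cnj)
  qed
  have S_vec: "((\<lambda>y. S (\<i> * of_real y)) has_vector_derivative \<i> * \<kappa> (\<i> * of_real y)) (at y)" for y
  proof -
    have "((\<lambda>y. \<i> * complex_of_real y) has_vector_derivative \<i>) (at y)"
      by (auto intro!: derivative_eq_intros)
    from field_vector_diff_chain_at[OF this S] show ?thesis by (simp add: o_def mult.commute)
  qed
  define p where "p y = Im (S (\<i> * of_real y))" for y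
  have p_deriv: "(p has_field_derivative (norm (kern_transform (\<i> * of_real y)))\<^sup>2) (at y)" for y
    unfolding p_def has_real_derivative_iff_has_vector_derivative
    using bounded_linear.has_vector_derivative[OF bounded_linear_Im S_vec[of y]] by (simp add: \<kappa>_im)
  have "((\<lambda>y. Re (S (\<i> * of_real y))) has_field_derivative 0) (at y)" for y
    unfolding has_real_derivative_iff_has_vector_derivative
    using bounded_linear.has_vector_derivative[OF bounded_linear_Re S_vec[of y]] by (simp add: \<kappa>_im)
  from DERIV_isconst_all[OF allI, OF this, of _ 0] have Re0: "Re (S (\<i> * of_real y)) = 0" for y
    by simp
  have S_p: "S (\<i> * of_real y) = \<i> * of_real (p y)" for y
    using Re0[of y] by (simp add: p_def complex_eq_iff)
  have p_mono: "p a \<le> p b" if "a \<le> b" for a b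
    by (rule DERIV_nonneg_imp_nondecreasing[OF that]) (use p_deriv in fastforce)
  \<comment> \<open>If \<open>p\<close> were constant on an interval, \<open>kern_transform\<close>
    would vanish on an uncountable set and hence everywhere, against its value at 0.\<close>
  have p_strict: "p a < p b" if "a < b" for a b
  proof (rule ccontr)
    assume "\<not> p a < p b"
    hence const: "p y = p a" if "y \<in> {a<..<b}" for y
      using p_mono[of a y] p_mono[of y b] that by auto
    have z: "kern_transform (\<i> * of_real y) = 0" if "y \<in> {a<..<b}" for y
    proof -
      have "((\<lambda>_. p a) has_field_derivative (norm (kern_transform (\<i> * of_real y)))\<^sup>2) (at y)"
        by (rule has_field_derivative_transform_within_open[OF p_deriv open_greaterThanLessThan that])
          (use const in auto)
      from DERIV_unique[OF this DERIV_const] show ?thesis by simp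
    qed
    have "kern_transform = (\<lambda>_. 0)"
    proof (rule holomorphic_countable_equal_UNIV[OF kern_transform_holomorphic])
      have "inj_on (\<lambda>y. \<i> * complex_of_real y) {a<..<b}" by (auto simp: inj_on_def)
      hence "uncountable ((\<lambda>y. \<i> * complex_of_real y) ` {a<..<b})"
        using uncountable_open_interval[of a b] that countable_image_inj_eq by blast
      moreover have "(\<lambda>y. \<i> * complex_of_real y) ` {a<..<b} \<subseteq> {z. kern_transform z = 0}"
        using z by auto
      ultimately show "uncountable {z. kern_transform z = 0}" using countable_subset by blast
    qed auto
    thus False using kern_transform_0 by (metis (full_types))
  qed
  have bound: "norm (\<kappa> z) \<le> 1 / (Im z - pi / 2)\<^sup>2" if "Im z > pi / 2" for z
  proof -
    have "Im z > 0" using that pi_half_gt_zero by linarith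
    hence p: "\<bar>Im z\<bar> = Im z" "\<bar>Im (- z)\<bar> = Im z" by auto
    have "norm (\<kappa> z) \<le> 1 / (Im z - pi / 2) * (1 / (Im z - pi / 2))"
      unfolding \<kappa>_def norm_mult using norm_kern_transform_le[of z] norm_kern_transform_le[of "- z"] that p
      by (intro mult_mono) auto
    thus ?thesis by (simp add: power2_eq_square)
  qed
  obtain L where L: "\<And>z. Im z > pi / 2 \<Longrightarrow> norm (S z - L) \<le> 1 / (Im z - pi / 2)"
      and lim: "(\<lambda>n. S (\<i> * of_nat n)) \<longlonglongrightarrow> L"
    using uniform_limit_of_inverse_square_derivative[OF S bound Re0] by blast
  have lim_p: "(\<lambda>n. p (real n)) \<longlonglongrightarrow> Im L"
    using tendsto_Im[OF lim] by (simp add: p_def)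
  have "(\<lambda>n. Re (S (\<i> * of_nat n))) \<longlonglongrightarrow> Re L" by (rule tendsto_Re[OF lim])
  moreover have "Re (S (\<i> * of_nat n)) = 0" for n using Re0[of "real n"] by simp
  ultimately have "Re L = 0" by (simp add: LIMSEQ_const_iff)
  \<comment> \<open>The detour through \<open>p 1\<close> keeps the inequality
    \<open>p 0 < Im L\<close> strict in the limit.\<close>
  have "p 1 \<le> Im L"
    by (rule LIMSEQ_le_const[OF lim_p]) (auto intro!: exI[of _ 1] p_mono)
  moreover have "p 0 = 0" by (simp add: p_def)
  ultimately have l: "Im L > 0" using p_strict[of 0 1] by simp
  hence "L \<noteq> 0" by auto
  have L_eq: "L = \<i> * of_real (Im L)" using \<open>Re L = 0\<close> by (simp add: complex_eq_iff)
  define \<sigma> where "\<sigma> z = (S z / L + 1) / 2" for z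
  show ?thesis
  proof (rule that[of \<sigma>])
    have "S holomorphic_on UNIV" using S by (auto simp: holomorphic_on_open)
    thus "\<sigma> holomorphic_on UNIV"
      unfolding \<sigma>_def by (intro holomorphic_intros) (use \<open>L \<noteq> 0\<close> in auto)
    show "\<sigma> 0 = 1 / 2" by (simp add: \<sigma>_def)
    have Re_\<sigma>: "Re (\<sigma> (\<i> * of_real y)) = (p y / Im L + 1) / 2" for y
    proof -
      have "S (\<i> * of_real y) / L = of_real (p y / Im L)"
        using l by (subst L_eq) (simp add: S_p)
      thus ?thesis by (simp add: \<sigma>_def del: of_real_divide)
    qed
    show "Re (\<sigma> (\<i> * of_real a)) < Re (\<sigma> (\<i> * of_real b))" if "a < b" for a b
      using p_strict[OF that] l unfolding Re_\<sigma> by (simp add: divide_strict_right_mono)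
    fix \<epsilon> :: real assume "\<epsilon> > 0"
    \<comment> \<open>Chosen so that the error \<open>1 / (R - pi / 2)\<close> of \<open>S\<close>,
      divided by \<open>2 * norm L\<close>, is exactly \<open>\<epsilon>\<close>.\<close>
    define R where "R = pi / 2 + 1 / (2 * Im L * \<epsilon>)"
    have "R > pi / 2" using l \<open>\<epsilon> > 0\<close> by (simp add: R_def)
    have upper: "norm (\<sigma> z - 1) \<le> \<epsilon>" if "Im z \<ge> R" for z
    proof -
      have "norm (S z - L) \<le> 1 / (Im z - pi / 2)"
        using L that \<open>R > pi / 2\<close> by auto
      also have "\<dots> \<le> 1 / (1 / (2 * Im L * \<epsilon>))"
      proof (intro divide_left_mono mult_pos_pos)
        show "1 / (2 * Im L * \<epsilon>) \<le> Im z - pi / 2" using that by (simp add: R_def)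
        show "Im z - pi / 2 > 0" using that \<open>R > pi / 2\<close> by simp
      qed (use l \<open>\<epsilon> > 0\<close> in auto)
      finally have "norm (S z - L) \<le> 2 * Im L * \<epsilon>" by simp
      moreover have "\<sigma> z - 1 = (S z - L) / (2 * L)"
        using \<open>L \<noteq> 0\<close> by (simp add: \<sigma>_def field_simps)
      moreover have "norm L = Im L"
        using \<open>Re L = 0\<close> l by (simp add: cmod_def)
      ultimately show ?thesis using l by (simp add: norm_divide norm_mult field_simps)
    qed
    have "norm (\<sigma> z) \<le> \<epsilon>" if "Im z \<le> - R" for z
    proof -
      have "\<sigma> z = - (\<sigma> (- z) - 1)" by (simp add: \<sigma>_def odd field_simps)
      thus ?thesis using upper[of "- z"] that by (simp add: norm_minus_commute)
    qed
    with upper show "\<exists>R>0. \<forall>z. (Im z \<le> - R \<longrightarrow> norm (\<sigma> z) \<le> \<epsilon>) \<and> (Im z \<ge> R \<longrightarrow> norm (\<sigma> z - 1) \<le> \<epsilon>)"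
      using \<open>R > pi / 2\<close> pi_half_gt_zero by (metis less_trans)
  qed
qed

section \<open>A single step with prescribed values on the imaginary axis\<close>

text \<open>Two scalings of the step are used. A steep one gives the approximate jump; a fixed one,
  injective on the imaginary axis, gives Lagrange polynomials that repair the values at the nodes.
  Their bounds outside the strip do not depend on the steepness, so the repair is as small as the
  node errors require.\<close>

lemma ex_step_interpolation:
  fixes Y :: "real set" and d v :: complex
  assumes "finite Y" "r > 0" "\<epsilon> > 0"
  obtains s where "s holomorphic_on UNIV"
    and "\<And>z. Im z \<le> y\<^sub>0 - r \<Longrightarrow> norm (s z) \<le> \<epsilon>"
    and "\<And>z. Im z \<ge> y\<^sub>0 + r \<Longrightarrow> norm (s z - d) \<le> \<epsilon>"
    and "s (\<i> * of_real y\<^sub>0) = v"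
    and "\<And>y. y \<in> Y \<Longrightarrow> y \<le> y\<^sub>0 - r \<Longrightarrow> s (\<i> * of_real y) = 0"
    and "\<And>y. y \<in> Y \<Longrightarrow> y \<ge> y\<^sub>0 + r \<Longrightarrow> s (\<i> * of_real y) = d"
proof -
  obtain \<sigma> where \<sigma>: "\<sigma> holomorphic_on UNIV" "\<sigma> 0 = 1 / 2"
    and \<sigma>_strict: "\<And>a b. a < b \<Longrightarrow> Re (\<sigma> (\<i> * of_real a)) < Re (\<sigma> (\<i> * of_real b))"
    and \<sigma>_lim: "\<And>\<epsilon>. \<epsilon> > 0 \<Longrightarrow>
      \<exists>R>0. \<forall>z. (Im z \<le> - R \<longrightarrow> norm (\<sigma> z) \<le> \<epsilon>) \<and> (Im z \<ge> R \<longrightarrow> norm (\<sigma> z - 1) \<le> \<epsilon>)"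
    by (rule ex_entire_step) blast
  define scaled where "scaled R z = \<sigma> (of_real (R / r) * (z - \<i> * of_real y\<^sub>0))" for R z
  have hol: "scaled R holomorphic_on UNIV" for R
  proof -
    have "(\<sigma> \<circ> (\<lambda>z. of_real (R / r) * (z - \<i> * of_real y\<^sub>0))) holomorphic_on UNIV"
      by (intro holomorphic_on_compose holomorphic_on_subset[OF \<sigma>(1)] holomorphic_intros) auto
    thus ?thesis by (simp add: scaled_def[abs_def] o_def)
  qed
  have scaled_y0: "scaled R (\<i> * of_real y\<^sub>0) = 1 / 2" for R
    by (simp add: scaled_def \<sigma>)
  have ex_scale: "\<exists>R>0. \<forall>z. (Im z \<le> y\<^sub>0 - r \<longrightarrow> norm (scaled R z) \<le> e) \<and>
      (Im z \<ge> y\<^sub>0 + r \<longrightarrow> norm (scaled R z - 1) \<le> e)" if e: "e > 0" for e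
  proof -
    obtain R where R: "R > 0"
      "\<And>z. Im z \<le> - R \<Longrightarrow> norm (\<sigma> z) \<le> e" "\<And>z. Im z \<ge> R \<Longrightarrow> norm (\<sigma> z - 1) \<le> e"
      using \<sigma>_lim[OF e] by auto
    have im: "Im (of_real (R / r) * (z - \<i> * of_real y\<^sub>0)) = R / r * (Im z - y\<^sub>0)" for z
      by simp
    have "norm (scaled R z) \<le> e" if "Im z \<le> y\<^sub>0 - r" for z
    proof -
      have "R / r * (Im z - y\<^sub>0) \<le> R / r * (- r)"
        using that R \<open>r > 0\<close> by (intro mult_left_mono) auto
      also have "\<dots> = - R" using \<open>r > 0\<close> by simp
      finally show ?thesis unfolding scaled_def by (intro R(2)) (simp only: im)
    qed
    moreover have "norm (scaled R z - 1) \<le> e" if "Im z \<ge> y\<^sub>0 + r" for z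
    proof -
      have "R = R / r * r" using \<open>r > 0\<close> by simp
      also have "R / r * r \<le> R / r * (Im z - y\<^sub>0)"
        using that R \<open>r > 0\<close> by (intro mult_left_mono) auto
      finally show ?thesis unfolding scaled_def by (intro R(3)) (simp only: im)
    qed
    ultimately show ?thesis using R(1) by blast
  qed
  obtain R1 where "R1 > 0" and R1: "\<And>z. Im z \<le> y\<^sub>0 - r \<Longrightarrow> norm (scaled R1 z) \<le> 1"
      "\<And>z. Im z \<ge> y\<^sub>0 + r \<Longrightarrow> norm (scaled R1 z - 1) \<le> 1"
    using ex_scale[of 1] by auto
  define \<phi> where "\<phi> = scaled R1"
  have \<phi>_bound: "norm (\<phi> z) \<le> 2" if "Im z \<le> y\<^sub>0 - r \<or> Im z \<ge> y\<^sub>0 + r" for z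
    using that
  proof
    assume "Im z \<ge> y\<^sub>0 + r"
    hence "norm (\<phi> z - 1) \<le> 1" unfolding \<phi>_def by (rule R1)
    thus ?thesis using norm_triangle_ineq2[of "\<phi> z" 1] by simp
  qed (use R1(1)[of z] in \<open>simp add: \<phi>_def\<close>)
  have \<phi>_inj: "\<phi> (\<i> * of_real a) \<noteq> \<phi> (\<i> * of_real b)" if "a \<noteq> b" for a b
  proof -
    have *: "\<phi> (\<i> * of_real y) = \<sigma> (\<i> * of_real (R1 / r * (y - y\<^sub>0)))" for y
      by (simp add: \<phi>_def scaled_def algebra_simps diff_divide_distrib)
    have "\<phi> (\<i> * of_real a) \<noteq> \<phi> (\<i> * of_real b)" if "a < b" for a b
    proof -
      have "R1 / r * (a - y\<^sub>0) < R1 / r * (b - y\<^sub>0)"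
        using that \<open>R1 > 0\<close> \<open>r > 0\<close> by (intro mult_strict_left_mono) auto
      from \<sigma>_strict[OF this] show ?thesis unfolding * by (metis less_irrefl)
    qed
    thus ?thesis using \<open>a \<noteq> b\<close> by (metis linorder_neqE_linordered_idom)
  qed
  define Y' where "Y' = {y\<in>Y. y \<le> y\<^sub>0 - r \<or> y \<ge> y\<^sub>0 + r}"
  have "finite Y'" and "y\<^sub>0 \<notin> Y'" using assms by (auto simp: Y'_def)
  \<comment> \<open>The centre \<open>y\<^sub>0\<close> is added to the nodes so that every
    correction vanishes there and leaves the value \<open>v\<close> intact.\<close>
  define l where "l y z = (\<Prod>u\<in>insert y\<^sub>0 Y' - {y}.
    (\<phi> z - \<phi> (\<i> * of_real u)) / (\<phi> (\<i> * of_real y) - \<phi> (\<i> * of_real u)))" for y z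
  define M where "M y = (\<Prod>u\<in>insert y\<^sub>0 Y' - {y}.
    (2 + norm (\<phi> (\<i> * of_real u))) / norm (\<phi> (\<i> * of_real y) - \<phi> (\<i> * of_real u)))" for y
  have l_hol: "l y holomorphic_on UNIV" for y
    unfolding l_def using hol[of R1] \<phi>_inj by (intro holomorphic_intros) (auto simp: \<phi>_def)
  have l_bound: "norm (l y z) \<le> M y" if "Im z \<le> y\<^sub>0 - r \<or> Im z \<ge> y\<^sub>0 + r" for y z
  proof -
    have "norm (\<phi> z - a) \<le> 2 + norm a" for a
      using \<phi>_bound[OF that] norm_triangle_ineq4[of "\<phi> z" a] by linarith
    thus ?thesis
      unfolding l_def M_def prod_norm[symmetric] norm_divide
      by (intro prod_mono conjI divide_right_mono) auto
  qed
  have M_nonneg: "M y \<ge> 0" for y unfolding M_def by (intro prod_nonneg) auto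
  have l_self: "l y (\<i> * of_real y) = 1" if "y \<in> Y'" for y
    unfolding l_def by (intro prod.neutral) (use \<phi>_inj in auto)
  have l_other: "l y (\<i> * of_real u) = 0" if "u \<in> insert y\<^sub>0 Y'" "u \<noteq> y" for y u
    unfolding l_def using \<open>finite Y'\<close> that by (intro prod_zero) auto
  \<comment> \<open>The quadratic \<open>Q\<close> sends 0 to 0, 1 to \<open>d\<close>, and 1/2, the
    value of the step at the centre, to \<open>d / 2 + w / 4 = v\<close>.\<close>
  define w where "w = 4 * (v - d / 2)"
  define Q where "Q x = d * x + w * x * (1 - x)" for x
  define K where "K = norm d + 2 * norm w"
  define B where "B = 1 + sum M Y'"
  \<comment> \<open>Outside the strip \<open>Q\<close> errs by at most \<open>e * K\<close> and the
    corrections by at most \<open>e * K * sum M Y'\<close>, together \<open>e * K * B\<close>. The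
    cap 1 gives the factor 2 in \<open>K\<close>; \<open>K + 1\<close> avoids division by
    zero.\<close>
  define e where "e = min 1 (\<epsilon> / ((K + 1) * B))"
  have "K \<ge> 0" by (simp add: K_def)
  have "B \<ge> 1" using M_nonneg by (simp add: B_def sum_nonneg)
  have "e > 0" using \<open>K \<ge> 0\<close> \<open>B \<ge> 1\<close> \<open>\<epsilon> > 0\<close> by (simp add: e_def)
  have eKB: "e * K * B \<le> \<epsilon>"
  proof -
    have "e * K * B \<le> e * (K + 1) * B"
      using \<open>e > 0\<close> \<open>B \<ge> 1\<close> by (intro mult_right_mono mult_left_mono) auto
    also have "\<dots> \<le> \<epsilon> / ((K + 1) * B) * (K + 1) * B"
      using \<open>K \<ge> 0\<close> \<open>B \<ge> 1\<close> by (intro mult_right_mono) (auto simp: e_def)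
    also have "\<dots> = \<epsilon>" using \<open>K \<ge> 0\<close> \<open>B \<ge> 1\<close> by simp
    finally show ?thesis .
  qed
  obtain R where R: "\<And>z. Im z \<le> y\<^sub>0 - r \<Longrightarrow> norm (scaled R z) \<le> e"
      "\<And>z. Im z \<ge> y\<^sub>0 + r \<Longrightarrow> norm (scaled R z - 1) \<le> e"
    using ex_scale[OF \<open>e > 0\<close>] by auto
  have Q0: "norm (Q x) \<le> e * K" if "norm x \<le> e" for x
  proof -
    have "norm (1 - x) \<le> 2"
      using that norm_triangle_ineq4[of 1 x] by (simp add: e_def)
    hence "norm (d + w * (1 - x)) \<le> norm d + norm w * 2"
      by (intro norm_triangle_le add_mono) (auto simp: norm_mult intro: mult_left_mono)
    hence "norm x * norm (d + w * (1 - x)) \<le> e * K"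
      using that \<open>e > 0\<close> by (intro mult_mono) (auto simp: K_def)
    moreover have "Q x = x * (d + w * (1 - x))" by (simp add: Q_def algebra_simps)
    ultimately show ?thesis by (simp add: norm_mult)
  qed
  have Q1: "norm (Q x - d) \<le> e * K" if "norm (x - 1) \<le> e" for x
  proof -
    have "norm x \<le> 2"
      using that norm_triangle_ineq2[of x 1] by (simp add: e_def)
    hence "norm (d - w * x) \<le> norm d + norm w * 2"
      by (intro norm_triangle_le_diff add_mono) (auto simp: norm_mult intro: mult_left_mono)
    hence "norm (x - 1) * norm (d - w * x) \<le> e * K"
      using that \<open>e > 0\<close> by (intro mult_mono) (auto simp: K_def)
    moreover have "Q x - d = (x - 1) * (d - w * x)" by (simp add: Q_def algebra_simps)
    ultimately show ?thesis by (simp add: norm_mult)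
  qed
  define \<tau> where "\<tau> y = (if y \<le> y\<^sub>0 - r then 0 else d)" for y
  define q where "q z = Q (scaled R z)" for z
  define s where "s z = q z - (\<Sum>y\<in>Y'. (q (\<i> * of_real y) - \<tau> y) * l y z)" for z
  have corr: "norm (\<Sum>y\<in>Y'. (q (\<i> * of_real y) - \<tau> y) * l y z) \<le> e * K * sum M Y'"
    if "Im z \<le> y\<^sub>0 - r \<or> Im z \<ge> y\<^sub>0 + r" for z
  proof -
    have "norm (q (\<i> * of_real y) - \<tau> y) \<le> e * K" if "y \<in> Y'" for y
      using that Q0[OF R(1), of "\<i> * of_real y"] Q1[OF R(2), of "\<i> * of_real y"]
      by (auto simp: q_def \<tau>_def Y'_def)
    hence "norm (\<Sum>y\<in>Y'. (q (\<i> * of_real y) - \<tau> y) * l y z) \<le> (\<Sum>y\<in>Y'. e * K * M y)"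
      using l_bound[OF that] \<open>e > 0\<close> \<open>K \<ge> 0\<close>
      by (intro sum_norm_le) (auto simp: norm_mult intro!: mult_mono)
    thus ?thesis by (simp add: sum_distrib_left)
  qed
  show ?thesis
  proof (rule that[of s])
    show "s holomorphic_on UNIV"
      unfolding s_def q_def Q_def using hol[of R] l_hol by (intro holomorphic_intros) auto
    show "norm (s z) \<le> \<epsilon>" if "Im z \<le> y\<^sub>0 - r" for z
      using corr[of z] Q0[OF R(1)[OF that]] that eKB
        norm_triangle_ineq4[of "q z" "\<Sum>y\<in>Y'. (q (\<i> * of_real y) - \<tau> y) * l y z"]
      by (simp add: s_def q_def B_def algebra_simps)
    show "norm (s z - d) \<le> \<epsilon>" if "Im z \<ge> y\<^sub>0 + r" for z
      using corr[of z] Q1[OF R(2)[OF that]] that eKB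
        norm_triangle_ineq4[of "q z - d" "\<Sum>y\<in>Y'. (q (\<i> * of_real y) - \<tau> y) * l y z"]
      by (simp add: s_def q_def B_def algebra_simps)
    have "(\<Sum>y\<in>Y'. (q (\<i> * of_real y) - \<tau> y) * l y (\<i> * of_real y\<^sub>0)) = 0"
      by (intro sum.neutral ballI) (metis l_other \<open>y\<^sub>0 \<notin> Y'\<close> insertI1 mult_zero_right)
    thus "s (\<i> * of_real y\<^sub>0) = v"
      by (simp add: s_def q_def scaled_y0 Q_def w_def field_simps)
    have s_Y': "s (\<i> * of_real y) = \<tau> y" if "y \<in> Y'" for y
    proof -
      have "(\<Sum>u\<in>Y'. (q (\<i> * of_real u) - \<tau> u) * l u (\<i> * of_real y))
          = (\<Sum>u\<in>{y}. (q (\<i> * of_real u) - \<tau> u) * l u (\<i> * of_real y))"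
        using \<open>finite Y'\<close> that l_other by (intro sum.mono_neutral_right) auto
      thus ?thesis using l_self[OF that] by (simp add: s_def)
    qed
    show "s (\<i> * of_real y) = 0" if "y \<in> Y" "y \<le> y\<^sub>0 - r" for y
      using s_Y'[of y] that by (simp add: Y'_def \<tau>_def)
    show "s (\<i> * of_real y) = d" if "y \<in> Y" "y \<ge> y\<^sub>0 + r" for y
      using s_Y'[of y] that \<open>r > 0\<close> by (simp add: Y'_def \<tau>_def)
  qed
qed

section \<open>Interpolation along horizontal bands\<close>

text \<open>Only the bands around even heights are defined; the one around \<open>2 * n + 1\<close>
  is expressed as \<open>z + \<i> \<in> band (Suc n)\<close>. The half-height 3/4 makes neighbours
  overlap and leaves strips of height 1/2 for the jumps. The lowest band extends down without
  bound.\<close>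

definition band :: "nat \<Rightarrow> complex set" where
  "band n = {z. Im z \<le> 2 * real n + 3 / 4 \<and> (n = 0 \<or> 2 * real n - 3 / 4 \<le> Im z)}"

lemma node_in_band: "\<i> * of_nat (2 * n) \<in> band n"
  by (simp add: band_def)

text \<open>The function is \<open>c 0\<close> plus steps at the odd heights. Step \<open>n\<close>
  vanishes at all nodes up to \<open>2 * n\<close>, and its value at the next node and its jump are
  chosen to correct the partial sum at nodes \<open>2 * n + 1\<close> and \<open>2 * n + 2\<close>;
  later steps leave these values alone.\<close>

lemma ex_band_interpolation:
  fixes c :: "nat \<Rightarrow> complex"
  assumes "\<epsilon> > 0"
  obtains g where "g holomorphic_on UNIV"
    and "\<And>m. g (\<i> * of_nat m) = c m"
    and "\<And>n z. z \<in> band n \<Longrightarrow> norm (g z - c (2 * n)) \<le> \<epsilon>"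
proof -
  \<comment> \<open>The total is \<open>\<epsilon> / 2\<close>, since the error is counted twice: at
    \<open>z\<close> and at the central node of its band.\<close>
  define e where "e n = \<epsilon> / 4 * (1 / 2) ^ n" for n
  have e: "e sums (\<epsilon> / 2)"
    using sums_mult[OF geometric_sums[of "1 / 2 :: real"], of "\<epsilon> / 4"] by (simp add: e_def[abs_def])
  have e_pos: "e n > 0" for n using \<open>\<epsilon> > 0\<close> by (simp add: e_def)
  define P where "P n v d s \<longleftrightarrow> s holomorphic_on UNIV
      \<and> (\<forall>z. Im z \<le> 2 * real n + 3 / 4 \<longrightarrow> norm (s z) \<le> e n)
      \<and> (\<forall>z. Im z \<ge> 2 * real n + 5 / 4 \<longrightarrow> norm (s z - d) \<le> e n)
      \<and> s (\<i> * of_nat (2 * n + 1)) = v \<and> s (\<i> * of_nat (2 * n + 2)) = d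
      \<and> (\<forall>k\<le>2 * n. s (\<i> * of_nat k) = 0)" for n v d and s :: "complex \<Rightarrow> complex"
  have "\<exists>s. P n v d s" for n v d
  proof -
    have "finite (real ` {..2 * n + 2})" "0 < (1 / 4 :: real)" by auto
    from ex_step_interpolation[OF this e_pos[of n], of "real (2 * n + 1)" d v]
    obtain s where s: "s holomorphic_on UNIV"
      "\<And>z. Im z \<le> real (2 * n + 1) - 1 / 4 \<Longrightarrow> norm (s z) \<le> e n"
      "\<And>z. Im z \<ge> real (2 * n + 1) + 1 / 4 \<Longrightarrow> norm (s z - d) \<le> e n"
      "s (\<i> * of_real (real (2 * n + 1))) = v"
      "\<And>y. y \<in> real ` {..2 * n + 2} \<Longrightarrow> y \<le> real (2 * n + 1) - 1 / 4 \<Longrightarrow> s (\<i> * of_real y) = 0"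
      "\<And>y. y \<in> real ` {..2 * n + 2} \<Longrightarrow> y \<ge> real (2 * n + 1) + 1 / 4 \<Longrightarrow> s (\<i> * of_real y) = d"
      by blast
    have "norm (s z) \<le> e n" if "Im z \<le> 2 * real n + 3 / 4" for z
      using that by (intro s(2)) simp
    moreover have "norm (s z - d) \<le> e n" if "Im z \<ge> 2 * real n + 5 / 4" for z
      using that by (intro s(3)) simp
    moreover have "s (\<i> * of_nat (2 * n + 1)) = v" using s(4) by simp
    moreover have "s (\<i> * of_real (real (2 * n + 2))) = d" by (rule s(6)[OF imageI]) auto
    hence "s (\<i> * of_nat (2 * n + 2)) = d" by (simp only: of_real_of_nat_eq)
    moreover have "s (\<i> * of_nat k) = 0" if "k \<le> 2 * n" for k
    proof -
      have "real k \<le> real (2 * n)" using that by (simp only: of_nat_le_iff)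
      hence "real k \<le> real (2 * n + 1) - 1 / 4" by simp
      thus ?thesis using s(5)[of "real k"] that by auto
    qed
    ultimately show ?thesis unfolding P_def using s(1) by blast
  qed
  then obtain S where S: "\<And>n v d. P n v d (S n v d)" by metis
  \<comment> \<open>The data of each step depend on the preceding partial sum, hence the
    recursion.\<close>
  define G where "G = rec_nat (\<lambda>z. c 0) (\<lambda>n G z. G z +
    S n (c (2 * n + 1) - G (\<i> * of_nat (2 * n + 1))) (c (2 * n + 2) - G (\<i> * of_nat (2 * n + 2))) z)"
  define v where "v n = c (2 * n + 1) - G n (\<i> * of_nat (2 * n + 1))" for n
  define d where "d n = c (2 * n + 2) - G n (\<i> * of_nat (2 * n + 2))" for n
  define s where "s n = S n (v n) (d n)" for n
  have G0: "G 0 z = c 0" for z by (simp add: G_def)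
  have GSuc: "G (Suc n) z = G n z + s n z" for n z by (simp add: G_def s_def v_def d_def)
  have "P n (v n) (d n) (s n)" for n using S by (simp add: s_def)
  hence hol: "\<And>n. s n holomorphic_on UNIV"
    and low: "\<And>n z. Im z \<le> 2 * real n + 3 / 4 \<Longrightarrow> norm (s n z) \<le> e n"
    and high: "\<And>n z. Im z \<ge> 2 * real n + 5 / 4 \<Longrightarrow> norm (s n z - d n) \<le> e n"
    and s_v: "\<And>n. s n (\<i> * of_nat (2 * n + 1)) = v n"
    and s_d: "\<And>n. s n (\<i> * of_nat (2 * n + 2)) = d n"
    and s_0: "\<And>n k. k \<le> 2 * n \<Longrightarrow> s n (\<i> * of_nat k) = 0"
    unfolding P_def by blast+
  have G_sum: "G n z = c 0 + (\<Sum>k<n. s k z)" for n z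
    by (induction n) (auto simp: G0 GSuc)
  have bound: "\<exists>N M. summable M \<and> (\<forall>n\<ge>N. \<forall>z. norm z \<le> R \<longrightarrow> norm (s n z) \<le> M n)" for R
  proof -
    obtain N where N: "R \<le> real N" using real_arch_simple by blast
    have "norm (s n z) \<le> e n" if "n \<ge> N" "norm z \<le> R" for n z
    proof -
      have "real N \<le> real n" using that by simp
      thus ?thesis using N that abs_Im_le_cmod[of z] by (intro low) linarith
    qed
    thus ?thesis using sums_summable[OF e] by blast
  qed
  define g where "g z = c 0 + (\<Sum>k. s k z)" for z
  have g_G: "g (\<i> * of_nat m) = G n (\<i> * of_nat m)" if "m \<le> 2 * n" for m n
    unfolding g_def G_sum using that
    by (subst suminf_finite[of "{..<n}"]) (auto intro!: s_0)
  have g_node: "g (\<i> * of_nat m) = c m" for m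
  proof -
    consider "m = 0" | n where "m = 2 * n + 1" | n where "m = 2 * n + 2"
    proof (cases "even m")
      case True
      then obtain k where "m = 2 * k" by blast
      thus ?thesis using that(1) that(3)[of "k - 1"] by (cases k) auto
    qed (use that(2) in \<open>auto elim: oddE\<close>)
    thus ?thesis
    proof cases
      case 1
      thus ?thesis using g_G[of 0 0] by (simp add: G0)
    next
      case (2 n)
      thus ?thesis using g_G[of m "Suc n"] s_v[of n] by (simp add: GSuc v_def)
    next
      case (3 n)
      thus ?thesis using g_G[of m "Suc n"] s_d[of n] by (simp add: GSuc d_def)
    qed
  qed
  show ?thesis
  proof (rule that[of g])
    show "g holomorphic_on UNIV"
      unfolding g_def by (intro holomorphic_intros entire_series(1)[OF hol bound])
    show "g (\<i> * of_nat m) = c m" for m by (rule g_node)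
    fix n z assume z: "z \<in> band n"
    \<comment> \<open>On \<open>band n\<close> the steps below \<open>n\<close> are complete and the
      others have not begun, so \<open>D k\<close> is the ideal value of step
      \<open>k\<close>.\<close>
    define D where "D k = (if k < n then d k else 0)" for k
    have D_sum: "D sums (\<Sum>k<n. D k)"
      by (rule sums_finite) (auto simp: D_def)
    have near: "norm (g z - (c 0 + (\<Sum>k<n. D k))) \<le> \<epsilon> / 2" if z: "z \<in> band n" for z
    proof -
      have "norm (s k z - D k) \<le> e k" for k
      proof (cases "k < n")
        case True
        hence "real (Suc k) \<le> real n" by (simp only: of_nat_le_iff Suc_le_eq)
        thus ?thesis using high[of k z] True z by (auto simp: D_def band_def)
      next
        case False
        hence "real n \<le> real k" by simp
        thus ?thesis using low[of z k] False z by (auto simp: D_def band_def)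
      qed
      moreover have "(\<lambda>k. s k z - D k) sums ((\<Sum>k. s k z) - (\<Sum>k<n. D k))"
        by (intro sums_diff D_sum summable_sums entire_series(2)[OF hol bound])
      ultimately have "norm ((\<Sum>k. s k z) - (\<Sum>k<n. D k)) \<le> \<epsilon> / 2"
        using norm_suminf_le[of "\<lambda>k. s k z - D k" e] e by (auto simp: sums_iff)
      thus ?thesis by (simp add: g_def)
    qed
    have "norm (g z - g (\<i> * of_nat (2 * n))) \<le> \<epsilon>"
      using near[OF z] near[OF node_in_band]
        norm_triangle_ineq4[of "g z - (c 0 + (\<Sum>k<n. D k))" "g (\<i> * of_nat (2 * n)) - (c 0 + (\<Sum>k<n. D k))"]
      by (simp del: of_nat_mult)
    thus "norm (g z - c (2 * n)) \<le> \<epsilon>" by (simp only: g_node)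
  qed
qed

section \<open>Perturbations with prescribed noncritical points\<close>

text \<open>Dividing by a power of \<open>z - w\<close> does not increase the modulus at distance at
  least 1 from \<open>w\<close>; compactness handles the remaining disc.\<close>

lemma bounded_on_of_quotient:
  fixes \<psi> \<theta> :: "complex \<Rightarrow> complex"
  assumes "\<psi> holomorphic_on UNIV" and "\<And>z. z \<in> A \<Longrightarrow> norm (\<theta> z) \<le> B"
    and "\<And>z. norm (z - w) \<ge> 1 \<Longrightarrow> norm (\<psi> z) \<le> norm (\<theta> z)"
  shows "\<exists>B. \<forall>z\<in>A. norm (\<psi> z) \<le> B"
proof -
  have "continuous_on (cball w 1) \<psi>"
    using assms(1) holomorphic_on_imp_continuous_on continuous_on_subset by blast
  hence "bounded (\<psi> ` cball w 1)"
    by (intro compact_imp_bounded compact_continuous_image) auto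
  then obtain M where M: "\<And>z. z \<in> cball w 1 \<Longrightarrow> norm (\<psi> z) \<le> M"
    unfolding bounded_iff by blast
  have "norm (\<psi> z) \<le> max M B" if "z \<in> A" for z
  proof (cases "z \<in> cball w 1")
    case False
    hence "norm (z - w) \<ge> 1" by (simp add: dist_norm norm_minus_commute)
    from order_trans[OF assms(3)[OF this] assms(2)[OF that]] show ?thesis by simp
  qed (use M in \<open>auto simp: le_max_iff_disj\<close>)
  thus ?thesis by blast
qed

text \<open>Dividing \<open>\<theta>\<close> by powers of \<open>z - w\<close> keeps it bounded on \<open>A\<close>, so a zero at \<open>w\<close> can be made simple.
  If \<open>w\<close> is not a zero, but a critical point of \<open>\<theta>\<close>, then \<open>\<theta>\<^sup>2 / (z - b)\<close> is not critical at \<open>w\<close>.\<close>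

lemma ex_bounded_vanishing_deriv_nonzero:
  fixes \<theta> :: "complex \<Rightarrow> complex"
  assumes hol: "\<theta> holomorphic_on UNIV" and zero: "\<And>z. z \<in> Z \<Longrightarrow> \<theta> z = 0"
    and bound: "\<And>z. z \<in> A \<Longrightarrow> norm (\<theta> z) \<le> B"
    and nz: "\<theta> u \<noteq> 0" and b: "b \<in> Z"
  shows "\<exists>\<psi> B. \<psi> holomorphic_on UNIV \<and> (\<forall>z\<in>Z. \<psi> z = 0) \<and> (\<forall>z\<in>A. norm (\<psi> z) \<le> B)
    \<and> deriv \<psi> w \<noteq> 0"
proof (cases "\<theta> w = 0")
  case True
  have "\<not> \<theta> constant_on UNIV"
    using nz True unfolding constant_on_def by (metis UNIV_I)
  then obtain g r n where r: "0 < n" "0 < r" and g: "g holomorphic_on ball w r"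
    and fac: "\<And>z. z \<in> ball w r \<Longrightarrow> \<theta> z = (z - w) ^ n * g z"
    and g0: "\<And>z. z \<in> ball w r \<Longrightarrow> g z \<noteq> 0"
    by (rule holomorphic_factor_zero_nonconstant[OF hol open_UNIV connected_UNIV UNIV_I True]) blast
  \<comment> \<open>One factor \<open>z - w\<close> is kept, so 0 is the correct value at
    \<open>w\<close>, and zeros of \<open>\<theta>\<close> remain zeros.\<close>
  define \<psi> where "\<psi> z = (if z = w then 0 else \<theta> z / (z - w) ^ (n - 1))" for z
  have eq: "\<psi> z = (z - w) * g z" if "z \<in> ball w r" for z
  proof -
    have "(z - w) ^ n = (z - w) * (z - w) ^ (n - 1)" using r by (simp add: power_eq_if)
    thus ?thesis using fac[OF that] by (auto simp: \<psi>_def)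
  qed
  have der: "((\<lambda>z. (z - w) * g z) has_field_derivative g w) (at w)"
    using r by (auto intro!: derivative_eq_intros holomorphic_derivI[OF g])
  have "(\<psi> has_field_derivative g w) (at w)"
    by (rule has_field_derivative_transform_within_open[OF der, of "ball w r"]) (use r eq in auto)
  hence "deriv \<psi> w \<noteq> 0" using g0[of w] r DERIV_imp_deriv by fastforce
  moreover have "\<psi> holomorphic_on UNIV"
  proof -
    have "(\<lambda>z. (z - w) * g z) holomorphic_on ball w r" by (intro holomorphic_intros g)
    hence 1: "\<psi> holomorphic_on ball w r" by (rule holomorphic_transform) (simp only: eq)
    have "(\<lambda>z. \<theta> z / (z - w) ^ (n - 1)) holomorphic_on (- {w})"
      by (intro holomorphic_intros holomorphic_on_subset[OF hol]) auto
    hence 2: "\<psi> holomorphic_on (- {w})" by (rule holomorphic_transform) (auto simp: \<psi>_def)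
    have "UNIV = ball w r \<union> - {w}" using r by auto
    thus ?thesis using holomorphic_on_Un[OF 1 2] by auto
  qed
  moreover have "\<exists>B. \<forall>z\<in>A. norm (\<psi> z) \<le> B"
  proof (rule bounded_on_of_quotient[OF calculation(2) bound])
    fix z assume z: "norm (z - w) \<ge> 1"
    have "norm (z - w) ^ (n - 1) \<ge> 1" by (rule one_le_power[OF z])
    hence "norm (\<theta> z) / norm (z - w) ^ (n - 1) \<le> norm (\<theta> z) / 1"
      by (intro divide_left_mono mult_pos_pos norm_ge_zero) linarith+
    thus "norm (\<psi> z) \<le> norm (\<theta> z)" by (simp add: \<psi>_def norm_divide norm_power)
  qed
  moreover have "\<forall>z\<in>Z. \<psi> z = 0" using zero by (simp add: \<psi>_def)
  ultimately show ?thesis by blast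
next
  case False
  show ?thesis
  proof (cases "deriv \<theta> w = 0")
    case True
    define \<eta> where "\<eta> z = (if z = b then deriv \<theta> b else (\<theta> z - \<theta> b) / (z - b))" for z
    have "\<theta> b = 0" using zero b by blast
    have \<eta>: "\<eta> holomorphic_on UNIV"
      using pole_lemma[OF hol, of b] by (simp add: \<eta>_def[abs_def])
    have fac: "\<theta> z = (z - b) * \<eta> z" for z using \<open>\<theta> b = 0\<close> by (simp add: \<eta>_def)
    have der: "(\<theta> has_field_derivative \<eta> w + (w - b) * deriv \<eta> w) (at w)"
      unfolding fac[abs_def] by (auto intro!: derivative_eq_intros holomorphic_derivI[OF \<eta>])
    \<comment> \<open>As \<open>\<eta> w\<close> is nonzero, this relation forces
      \<open>deriv \<eta> w\<close> to be nonzero too; the derivative of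
      \<open>\<theta> * \<eta>\<close> at \<open>w\<close> then reduces to
      \<open>\<theta> w * deriv \<eta> w\<close>.\<close>
    hence "\<eta> w + (w - b) * deriv \<eta> w = 0" using True DERIV_imp_deriv by metis
    moreover have "\<eta> w \<noteq> 0" using False fac[of w] by auto
    ultimately have "deriv \<eta> w \<noteq> 0" by auto
    have "((\<lambda>z. \<theta> z * \<eta> z) has_field_derivative deriv \<theta> w * \<eta> w + \<theta> w * deriv \<eta> w) (at w)"
      by (auto intro!: derivative_eq_intros holomorphic_derivI[OF \<eta>] holomorphic_derivI[OF hol])
    hence "deriv (\<lambda>z. \<theta> z * \<eta> z) w \<noteq> 0"
      using True False \<open>deriv \<eta> w \<noteq> 0\<close> DERIV_imp_deriv by fastforce
    moreover have "\<exists>B. \<forall>z\<in>A. norm (\<eta> z) \<le> B"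
    proof (rule bounded_on_of_quotient[OF \<eta> bound])
      fix z assume z: "norm (z - b) \<ge> 1"
      hence "1 * norm (\<eta> z) \<le> norm (z - b) * norm (\<eta> z)" by (intro mult_right_mono) auto
      thus "norm (\<eta> z) \<le> norm (\<theta> z)" by (simp add: fac norm_mult)
    qed
    then obtain B' where B': "\<forall>z\<in>A. norm (\<eta> z) \<le> B'" by blast
    have "norm (\<theta> z * \<eta> z) \<le> B * B'" if "z \<in> A" for z
      unfolding norm_mult using bound[OF that] B' that norm_ge_zero
      by (intro mult_mono) (auto intro: order_trans[OF norm_ge_zero])
    moreover have "(\<lambda>z. \<theta> z * \<eta> z) holomorphic_on UNIV" by (intro holomorphic_intros hol \<eta>)
    ultimately show ?thesis using zero by (intro exI[of _ "\<lambda>z. \<theta> z * \<eta> z"] exI[of _ "B * B'"]) auto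
  qed (use assms in blast)
qed

text \<open>The sum vanishes at 0 and has a nonzero coefficient, so it is not constant; the compact
  disc inside the unit disc then holds only finitely many solutions.\<close>

lemma finite_zeros_power_series:
  fixes a :: "nat \<Rightarrow> complex"
  assumes sums: "\<And>x. norm x < 1 \<Longrightarrow> (\<lambda>k. a k * x ^ Suc k) sums f x" and "a j \<noteq> 0"
  shows "finite {x \<in> cball 0 (1 / 2). c + f x = 0}"
proof (rule holomorphic_compact_finite_zeros)
  define b where "b k = (case k of 0 \<Rightarrow> 0 | Suc k \<Rightarrow> a k)" for k
  have b: "(\<lambda>k. b k * x ^ k) sums f x" if "norm x < 1" for x
    using sums_Suc[of "\<lambda>k. b k * x ^ k" "f x"] sums[OF that] by (simp add: b_def)
  have "f holomorphic_on ball 0 1"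
    by (rule power_series_holomorphic[of _ _ b]) (use b in auto)
  thus "(\<lambda>x. c + f x) holomorphic_on ball 0 1" by (intro holomorphic_intros)
  have "f 0 = 0" using sums_unique2[OF b[of 0] sums_finite[of "{0}"]] by (auto simp: b_def)
  have "b (Suc j) \<noteq> 0" using assms(2) by (simp add: b_def)
  then obtain s where s: "s > 0" "\<And>z. z \<in> cball 0 s - {0} \<Longrightarrow> f z \<noteq> 0"
    using powser_0_nonzero[of 1 0 b f "Suc j"] b \<open>f 0 = 0\<close> by (auto simp: b_def)
  define x where "x = complex_of_real (min s (1 / 2))"
  have "f x \<noteq> 0" by (rule s(2)) (use s(1) in \<open>auto simp: x_def\<close>)
  moreover have "x \<in> ball 0 1" using s(1) by (auto simp: x_def)
  ultimately show "\<not> (\<lambda>x. c + f x) constant_on ball 0 1"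
    using \<open>f 0 = 0\<close> unfolding constant_on_def
    by (metis add_left_cancel centre_in_ball zero_less_one)
qed auto

text \<open>The perturbation is a series with coefficients \<open>x ^ Suc k\<close>: at each \<open>w \<in> W\<close> the derivative is
  then a nonconstant power series in \<open>x\<close>, with finitely many zeros in \<open>cball 0 (1 / 2)\<close>.\<close>

lemma ex_perturbation_deriv_nonzero:
  fixes g :: "complex \<Rightarrow> complex"
  assumes "countable W" "\<epsilon> > 0"
    and ex: "\<And>w. w \<in> W \<Longrightarrow> \<exists>\<psi> B. \<psi> holomorphic_on UNIV \<and> (\<forall>z\<in>Z. \<psi> z = 0)
      \<and> (\<forall>z\<in>A. norm (\<psi> z) \<le> B) \<and> deriv \<psi> w \<noteq> 0"
    and g: "g holomorphic_on UNIV"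
  shows "\<exists>h. h holomorphic_on UNIV \<and> (\<forall>z\<in>Z. h z = g z) \<and> (\<forall>z\<in>A. norm (h z - g z) \<le> \<epsilon>)
    \<and> (\<forall>w\<in>W. deriv h w \<noteq> 0)"
proof (cases "W = {}")
  case False
  define w where "w = from_nat_into W"
  have w_in: "w k \<in> W" for k unfolding w_def using False by (rule from_nat_into)
  have "\<exists>\<psi> B. \<psi> holomorphic_on UNIV \<and> (\<forall>z\<in>Z. \<psi> z = 0)
      \<and> (\<forall>z\<in>A. norm (\<psi> z) \<le> B) \<and> deriv \<psi> (w k) \<noteq> 0" for k
    by (rule ex[OF w_in])
  then obtain \<psi> B where \<psi>: "\<And>k. \<psi> k holomorphic_on UNIV" "\<And>k z. z \<in> Z \<Longrightarrow> \<psi> k z = 0"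
    and B: "\<And>k z. z \<in> A \<Longrightarrow> norm (\<psi> k z) \<le> B k" and der: "\<And>k. deriv (\<psi> k) (w k) \<noteq> 0"
    by metis
  have "\<exists>M. \<forall>z\<in>cball 0 (real k). norm (\<psi> k z) \<le> M" for k
  proof -
    have "continuous_on (cball 0 (real k)) (\<psi> k)"
      using \<psi>(1) holomorphic_on_imp_continuous_on continuous_on_subset by blast
    hence "bounded (\<psi> k ` cball 0 (real k))"
      by (intro compact_imp_bounded compact_continuous_image) auto
    thus ?thesis by (auto simp: bounded_iff)
  qed
  then obtain M where M: "\<And>k z. norm z \<le> real k \<Longrightarrow> norm (\<psi> k z) \<le> M k"
    by (metis mem_cball_0)
  \<comment> \<open>One weight serves two purposes: \<open>B k\<close> controls the term on
    \<open>A\<close>, and \<open>M k\<close> controls it on the disc of radius \<open>k\<close>,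
    which gives convergence. The absolute values allow for negative bounds.\<close>
  define \<delta> where "\<delta> k = \<epsilon> * (1 / 2) ^ Suc k / (1 + \<bar>B k\<bar> + \<bar>M k\<bar>)" for k
  have \<delta>_pos: "\<delta> k > 0" for k using \<open>\<epsilon> > 0\<close> by (simp add: \<delta>_def)
  have \<delta>_le: "\<delta> k * t \<le> \<epsilon> * (1 / 2) ^ Suc k" if "t \<le> \<bar>B k\<bar> + \<bar>M k\<bar>" for k t
  proof -
    have "t / (1 + \<bar>B k\<bar> + \<bar>M k\<bar>) \<le> 1" using that by simp
    hence "\<epsilon> * (1 / 2) ^ Suc k * (t / (1 + \<bar>B k\<bar> + \<bar>M k\<bar>)) \<le> \<epsilon> * (1 / 2) ^ Suc k * 1"
      using \<open>\<epsilon> > 0\<close> by (intro mult_left_mono) auto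
    thus ?thesis by (simp add: \<delta>_def)
  qed
  have half: "(\<lambda>k. \<epsilon> * (1 / 2) ^ Suc k) sums \<epsilon>"
    using sums_mult[OF power_half_series, of \<epsilon>] by simp
  define s where "s x k z = of_real (\<delta> k) * x ^ Suc k * \<psi> k z" for x k z
  have s_le: "norm (s x k z) \<le> \<epsilon> * (1 / 2) ^ Suc k"
    if "norm x < 1" "norm (\<psi> k z) \<le> \<bar>B k\<bar> + \<bar>M k\<bar>" for x k z
  proof -
    have "norm (s x k z) = norm x ^ Suc k * (\<delta> k * norm (\<psi> k z))"
      using \<delta>_pos[of k] by (simp add: s_def norm_mult norm_power)
    also have "\<dots> \<le> 1 * (\<epsilon> * (1 / 2) ^ Suc k)"
      using that \<delta>_pos[of k] \<open>\<epsilon> > 0\<close>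
      by (intro mult_mono \<delta>_le power_le_one mult_nonneg_nonneg) (auto intro: less_imp_le)
    finally show ?thesis by simp
  qed
  have s_hol: "s x k holomorphic_on UNIV" for x k
    unfolding s_def by (intro holomorphic_intros \<psi>)
  have s_bound: "\<exists>N M. summable M \<and> (\<forall>n\<ge>N. \<forall>z. norm z \<le> R \<longrightarrow> norm (s x n z) \<le> M n)"
    if x: "norm x < 1" for x R
  proof -
    obtain N where N: "R \<le> real N" using real_arch_simple by blast
    have "norm (s x k z) \<le> \<epsilon> * (1 / 2) ^ Suc k" if "k \<ge> N" "norm z \<le> R" for k z
    proof -
      have "norm z \<le> real k" using that N by (meson of_nat_le_iff order_trans)
      from M[OF this] show ?thesis by (intro s_le[OF x]) linarith
    qed
    thus ?thesis using sums_summable[OF half] by blast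
  qed
  define \<Psi> where "\<Psi> x z = (\<Sum>k. s x k z)" for x z
  have \<Psi>_hol: "\<Psi> x holomorphic_on UNIV" if "norm x < 1" for x
    unfolding \<Psi>_def[abs_def] by (rule entire_series(1)[OF s_hol s_bound[OF that]])
  have \<Psi>_deriv: "(\<lambda>k. of_real (\<delta> k) * deriv (\<psi> k) z * x ^ Suc k) sums deriv (\<Psi> x) z"
    if "norm x < 1" for x z
  proof -
    have "deriv (s x k) z = of_real (\<delta> k) * deriv (\<psi> k) z * x ^ Suc k" for k
    proof (rule DERIV_imp_deriv)
      show "(s x k has_field_derivative of_real (\<delta> k) * deriv (\<psi> k) z * x ^ Suc k) (at z)"
        unfolding s_def[abs_def]
        by (auto intro!: derivative_eq_intros holomorphic_derivI[OF \<psi>(1)])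
    qed
    thus ?thesis
      using entire_series(3)[OF s_hol s_bound[OF that], of z] by (simp add: \<Psi>_def[abs_def])
  qed
  have finite_bad: "finite {x \<in> cball 0 (1 / 2). deriv g (w j) + deriv (\<Psi> x) (w j) = 0}" for j
  proof (rule finite_zeros_power_series)
    show "(\<lambda>k. of_real (\<delta> k) * deriv (\<psi> k) (w j) * x ^ Suc k) sums deriv (\<Psi> x) (w j)"
      if "norm x < 1" for x by (rule \<Psi>_deriv[OF that])
    show "of_real (\<delta> j) * deriv (\<psi> j) (w j) \<noteq> 0" using der[of j] \<delta>_pos[of j] by simp
  qed
  \<comment> \<open>The bad parameters for all points of \<open>W\<close> together form a countable
    set, which cannot exhaust the disc; one \<open>x\<close> therefore works for every
    point.\<close>
  define X where "X = (\<Union>j. {x \<in> cball 0 (1 / 2). deriv g (w j) + deriv (\<Psi> x) (w j) = 0})"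
  have "countable X"
    unfolding X_def by (rule countable_UN[OF countableI_type countable_finite[OF finite_bad]])
  have "\<not> cball 0 (1 / 2) \<subseteq> X"
  proof
    assume "cball 0 (1 / 2) \<subseteq> X"
    hence "countable (cball (0 :: complex) (1 / 2))" using \<open>countable X\<close> by (rule countable_subset)
    moreover have "uncountable (cball (0 :: complex) (1 / 2))" by (rule uncountable_cball) simp
    ultimately show False by contradiction
  qed
  then obtain x where x: "x \<in> cball 0 (1 / 2)" and bad: "x \<notin> X" by blast
  from x have x1: "norm x < 1" by simp
  define h where "h z = g z + \<Psi> x z" for z
  have "h holomorphic_on UNIV"
    unfolding h_def by (intro holomorphic_intros g \<Psi>_hol x1)
  moreover have "\<forall>z\<in>Z. h z = g z" by (simp add: h_def \<Psi>_def s_def \<psi>(2))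
  moreover have "norm (h z - g z) \<le> \<epsilon>" if "z \<in> A" for z
  proof -
    have "norm (s x k z) \<le> \<epsilon> * (1 / 2) ^ Suc k" for k
      by (rule s_le[OF x1]) (use B[OF that, of k] in linarith)
    hence "norm (\<Sum>k. s x k z) \<le> (\<Sum>k. \<epsilon> * (1 / 2) ^ Suc k)"
      using sums_summable[OF half] by (intro norm_suminf_le)
    thus ?thesis using half by (simp add: h_def \<Psi>_def sums_iff)
  qed
  moreover have "deriv h u \<noteq> 0" if "u \<in> W" for u
  proof -
    obtain j where "u = w j"
      using from_nat_into_surj[OF \<open>countable W\<close> \<open>u \<in> W\<close>] by (auto simp: w_def)
    have "deriv h u = deriv g u + deriv (\<Psi> x) u"
      unfolding h_def using g \<Psi>_hol[OF x1]
      by (intro deriv_add) (auto intro: holomorphic_on_imp_differentiable_at)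
    thus ?thesis using bad x \<open>u = w j\<close> by (auto simp: X_def)
  qed
  ultimately show ?thesis by blast
next
  case True
  thus ?thesis using g \<open>\<epsilon> > 0\<close> by (intro exI[of _ g]) auto
qed

text \<open>Half of the error goes to interpolation, half to a perturbation that vanishes at all
  nodes. The perturbation is built from \<open>t * (t - 1)\<close>, where \<open>t\<close> takes
  only the values 0 and 1 at the nodes and stays bounded on the bands.\<close>

lemma ex_band_interpolation_deriv_nonzero:
  fixes c :: "nat \<Rightarrow> complex"
  assumes "\<epsilon> > 0" "countable W"
  obtains g where "g holomorphic_on UNIV"
    and "\<And>m. g (\<i> * of_nat m) = c m"
    and "\<And>n z. z \<in> band n \<Longrightarrow> norm (g z - c (2 * n)) \<le> \<epsilon>"
    and "\<And>w. w \<in> W \<Longrightarrow> deriv g w \<noteq> 0"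
proof -
  obtain g where g: "g holomorphic_on UNIV" "\<And>m. g (\<i> * of_nat m) = c m"
    "\<And>n z. z \<in> band n \<Longrightarrow> norm (g z - c (2 * n)) \<le> \<epsilon> / 2"
    using ex_band_interpolation[of "\<epsilon> / 2" c] \<open>\<epsilon> > 0\<close> by auto
  obtain t where t: "t holomorphic_on UNIV"
    "\<And>m. t (\<i> * of_nat m) = (if m = 1 then 1 else 0)"
    "\<And>n z. z \<in> band n \<Longrightarrow> norm (t z - (if 2 * n = 1 then 1 else 0)) \<le> 1"
    using ex_band_interpolation[of 1 "\<lambda>m. if m = 1 then 1 else 0"] by auto
  define \<theta> where "\<theta> z = t z * (t z - 1)" for z
  define Z where "Z = range (\<lambda>m. \<i> * of_nat m)"
  define A where "A = (\<Union>n. band n)"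
  have \<theta>_Z: "\<theta> z = 0" if "z \<in> Z" for z using that by (auto simp: \<theta>_def Z_def t)
  have \<theta>_A: "norm (\<theta> z) \<le> 1 * 2" if "z \<in> A" for z
  proof -
    from that obtain n where "z \<in> band n" by (auto simp: A_def)
    \<comment> \<open>The exceptional node 1 is odd, so the constant attached to each band is
      0.\<close>
    moreover have "2 * n \<noteq> 1" by presburger
    ultimately have "norm (t z) \<le> 1" using t(3)[of z n] by simp
    moreover from this have "norm (t z - 1) \<le> 2" using norm_triangle_ineq4[of "t z" 1] by simp
    ultimately show ?thesis unfolding \<theta>_def norm_mult by (intro mult_mono) auto
  qed
  have "\<exists>u. \<theta> u \<noteq> 0"
  \<comment> \<open>Otherwise \<open>t\<close> would take values in \<open>{0, 1}\<close> only and
    be constant by connectedness, although it is 0 at node 0 and 1 at node 1.\<close>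
  proof (rule ccontr)
    assume "\<nexists>u. \<theta> u \<noteq> 0"
    hence "range t \<subseteq> {0, 1}" by (auto simp: \<theta>_def)
    hence "t constant_on UNIV"
      by (intro continuous_finite_range_constant holomorphic_on_imp_continuous_on t)
        (auto intro: finite_subset)
    hence "t (\<i> * of_nat 0) = t (\<i> * of_nat 1)" by (metis UNIV_I constant_on_def)
    thus False unfolding t(2) by simp
  qed
  then obtain u where u: "\<theta> u \<noteq> 0" by blast
  have \<theta>_hol: "\<theta> holomorphic_on UNIV" unfolding \<theta>_def by (intro holomorphic_intros t)
  have "\<i> * of_nat 0 \<in> Z" unfolding Z_def by (rule rangeI)
  note ideal = ex_bounded_vanishing_deriv_nonzero[where \<theta> = \<theta> and Z = Z and A = A,
    OF \<theta>_hol \<theta>_Z \<theta>_A u this]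
  from ex_perturbation_deriv_nonzero[OF \<open>countable W\<close> _ ideal g(1), of "\<epsilon> / 2"] \<open>\<epsilon> > 0\<close>
  obtain h where h: "h holomorphic_on UNIV" "\<And>z. z \<in> Z \<Longrightarrow> h z = g z"
    "\<And>z. z \<in> A \<Longrightarrow> norm (h z - g z) \<le> \<epsilon> / 2" "\<And>w. w \<in> W \<Longrightarrow> deriv h w \<noteq> 0" by auto
  show ?thesis
  proof (rule that[of h])
    show "h (\<i> * of_nat m) = c m" for m using h(2) g(2) by (simp add: Z_def)
    show "norm (h z - c (2 * n)) \<le> \<epsilon>" if "z \<in> band n" for n z
    proof -
      have "z \<in> A" using that by (auto simp: A_def)
      from h(3)[OF this] g(3)[OF that] norm_triangle_ineq[of "h z - g z" "g z - c (2 * n)"]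
      show ?thesis by simp
    qed
  qed (use h in auto)
qed

section \<open>Distances, the cover by bands, and the construction of the immersion\<close>

lemma set_distance_pos:
  assumes "set_distance A B > 0"
  obtains e where "e > 0" and "\<And>a b. a \<in> A \<Longrightarrow> b \<in> B \<Longrightarrow> e \<le> dist a b"
proof -
  \<comment> \<open>The distance may be infinite, so a real number strictly below it is
    taken.\<close>
  obtain e where e: "0 < ereal e" "ereal e < set_distance A B"
    using ereal_dense2[OF assms] by blast
  have "e \<le> dist a b" if "a \<in> A" "b \<in> B" for a b
  proof -
    have "set_distance A B \<le> ereal (dist a b)"
      unfolding set_distance_def using that by (intro INF_lower2[of "(a, b)"]) auto
    with e(2) have "ereal e < ereal (dist a b)" by (rule less_le_trans)
    thus ?thesis by simp
  qed
  thus ?thesis using e(1) by (intro that[of e]) auto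
qed

lemma dist_vec_less:
  fixes x y :: "complex ^ 'k"
  assumes "\<And>i. norm (x $ i - y $ i) \<le> \<epsilon>" "real CARD('k) * \<epsilon> < \<delta>"
  shows "dist x y < \<delta>"
proof -
  have "dist x y \<le> (\<Sum>i\<in>UNIV. norm ((x - y) $ i))"
    unfolding dist_norm norm_vec_def by (rule L2_set_le_sum) simp
  also have "\<dots> \<le> (\<Sum>i\<in>(UNIV::'k set). \<epsilon>)" using assms(1) by (intro sum_mono) simp
  finally show ?thesis using assms(2) by simp
qed

text \<open>The parity of an integer nearest to \<open>Im z\<close> selects the band; everything
  below height 3/4 falls into the lowest one.\<close>

lemma band_cover:
  obtains n where "z \<in> band n" | n where "z + \<i> \<in> band (Suc n)"
proof (cases "Im z \<le> 3 / 4")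
  case True
  thus ?thesis using that(1)[of 0] by (simp add: band_def)
next
  case False
  define m where "m = nat \<lfloor>Im z + 1 / 2\<rfloor>"
  have "real m = of_int \<lfloor>Im z + 1 / 2\<rfloor>" using False by (simp add: m_def)
  hence m: "real m \<le> Im z + 1 / 2" "Im z < real m + 1 / 2" by linarith+
  show ?thesis
  proof (cases "even m")
    case True
    then obtain n where n: "m = 2 * n" by blast
    thus ?thesis using m that(1)[of n] by (simp add: band_def)
  next
    case False
    then obtain n where "m = 2 * n + 1" by (elim oddE)
    thus ?thesis using m that(2)[of n] by (simp add: band_def)
  qed
qed

lemma countable_zeros_deriv:
  assumes "h holomorphic_on UNIV" "h a \<noteq> h b"
  shows "countable {z. deriv h z = 0}"
proof (rule ccontr)
  assume "uncountable {z. deriv h z = 0}"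
  hence "deriv h = (\<lambda>_. 0)"
    using assms(1) by (intro holomorphic_countable_equal_UNIV holomorphic_deriv) auto
  hence "(h has_field_derivative 0) (at z)" for z
    using holomorphic_derivI[OF assms(1), of z] by simp
  hence "\<exists>c. \<forall>z\<in>UNIV. h z = c" by (intro has_field_derivative_zero_constant) auto
  thus False using assms(2) by (metis UNIV_I)
qed

theorem proposition6:
  fixes F :: "(complex ^ 'k) set"
    and G :: "(complex ^ 'l) set"
    and C :: "((complex ^ 'k) \<times> (complex ^ 'l)) set"
  assumes "closed F" and "F \<subset> UNIV"
    and "closed G" and "G \<subset> UNIV"
    and "countable C"
    and "set_distance C (F \<times> G) > 0"
  shows "\<exists>f :: complex \<Rightarrow> (complex ^ 'k) \<times> (complex ^ 'l).
           holomorphic_immersion f \<and> C \<subseteq> range f \<and> range f \<subseteq> UNIV - F \<times> G"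
proof -
  obtain e where "e > 0" and e: "\<And>c x. c \<in> C \<Longrightarrow> x \<in> F \<times> G \<Longrightarrow> e \<le> dist c x"
    using set_distance_pos[OF assms(6)] by blast
  obtain p q where "p \<in> - F" "q \<in> - G" using assms(2,4) by blast
  moreover have "open (- F)" "open (- G)" using assms(1,3) by (simp_all add: open_Compl)
  ultimately obtain d1 d2 where "d1 > 0" "ball p d1 \<subseteq> - F" "d2 > 0" "ball q d2 \<subseteq> - G"
    by (meson open_contains_ball)
  \<comment> \<open>With \<open>e / 2\<close>, a point of \<open>C\<close> cannot have both
    components closer than \<open>\<delta>\<close> to \<open>F\<close> and \<open>G\<close>; with
    \<open>d1\<close> and \<open>d2\<close>, the point \<open>(p, q)\<close> is far from
    both.\<close>
  define \<delta> where "\<delta> = min (e / 2) (min d1 d2)"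
  have "\<delta> > 0" using \<open>e > 0\<close> \<open>d1 > 0\<close> \<open>d2 > 0\<close> by (simp add: \<delta>_def)
  \<comment> \<open>Inserting \<open>(p, q)\<close> makes both classes nonempty, so each can be
    enumerated by all natural numbers, possibly with repetitions.\<close>
  define CF where "CF = {c \<in> insert (p, q) C. ball (fst c) \<delta> \<inter> F = {}}"
  define CG where "CG = {c \<in> insert (p, q) C. ball (snd c) \<delta> \<inter> G = {}}"
  have "ball p \<delta> \<subseteq> ball p d1" "ball q \<delta> \<subseteq> ball q d2" by (auto simp: \<delta>_def)
  hence pq: "(p, q) \<in> CF" "(p, q) \<in> CG"
    using \<open>ball p d1 \<subseteq> - F\<close> \<open>ball q d2 \<subseteq> - G\<close> by (auto simp: CF_def CG_def)
  have "C \<subseteq> CF \<union> CG"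
  proof
    fix c assume c: "c \<in> C"
    show "c \<in> CF \<union> CG"
    proof (rule ccontr)
      assume "c \<notin> CF \<union> CG"
      then obtain x y where x: "dist (fst c) x < \<delta>" "x \<in> F" and y: "dist (snd c) y < \<delta>" "y \<in> G"
        using c by (auto simp: CF_def CG_def)
      have "e \<le> dist c (x, y)" using e[of c "(x, y)"] c x y by simp
      also have "\<dots> \<le> dist (fst c) x + dist (snd c) y"
        by (cases c) (simp add: dist_Pair_Pair sqrt_sum_squares_le_sum)
      also have "\<dots> < e" using x y by (simp add: \<delta>_def)
      finally show False by simp
    qed
  qed
  have "countable CF" "countable CG"
    unfolding CF_def CG_def by (rule countable_subset[OF Collect_restrict], use assms(5) in simp)+
  define \<alpha> where "\<alpha> = from_nat_into CF"
  define \<beta> where "\<beta> = from_nat_into CG"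
  have \<alpha>: "range \<alpha> = CF" and \<beta>: "range \<beta> = CG"
    unfolding \<alpha>_def \<beta>_def using \<open>countable CF\<close> \<open>countable CG\<close> pq
    by (auto intro!: range_from_nat_into)
  define N where "N m = (if even m then \<alpha> (m div 2) else \<beta> (m div 2))" for m
  have "\<exists>\<epsilon>>0. real K * \<epsilon> < \<delta>" for K
    by (rule exI[of _ "\<delta> / (real K + 1)"]) (use \<open>\<delta> > 0\<close> in \<open>simp add: field_simps\<close>)
  then obtain \<epsilon> \<epsilon>' where \<epsilon>: "\<epsilon> > 0" "real CARD('k) * \<epsilon> < \<delta>" and \<epsilon>': "\<epsilon>' > 0" "real CARD('l) * \<epsilon>' < \<delta>"
    by metis
  \<comment> \<open>The node values are shifted by one, so that translation by \<open>\<i>\<close>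
    centres the bands at odd heights. The free value at node 0 is made different from that at node
    1, which keeps the translate from being constant.\<close>
  have "\<exists>h. h holomorphic_on UNIV \<and>
      (\<forall>m. h (\<i> * of_nat m) = (if m = 0 then snd (N 0) $ j + 1 else snd (N (m - 1)) $ j)) \<and>
      (\<forall>n z. z \<in> band n \<longrightarrow>
        norm (h z - (if 2 * n = 0 then snd (N 0) $ j + 1 else snd (N (2 * n - 1)) $ j)) \<le> \<epsilon>')" for j
    by (rule ex_band_interpolation[OF \<epsilon>'(1),
          of "\<lambda>m. if m = 0 then snd (N 0) $ j + 1 else snd (N (m - 1)) $ j"]) blast
  then obtain H where H: "\<And>j. H j holomorphic_on UNIV"
    "\<And>j m. H j (\<i> * of_nat m) = (if m = 0 then snd (N 0) $ j + 1 else snd (N (m - 1)) $ j)"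
    "\<And>j n z. z \<in> band n \<Longrightarrow>
      norm (H j z - (if 2 * n = 0 then snd (N 0) $ j + 1 else snd (N (2 * n - 1)) $ j)) \<le> \<epsilon>'"
    by metis
  define h where "h j z = H j (z + \<i>)" for j z
  have h_hol: "h j holomorphic_on UNIV" for j
  proof -
    have "H j \<circ> (\<lambda>z. z + \<i>) holomorphic_on UNIV"
      by (intro holomorphic_on_compose holomorphic_intros holomorphic_on_subset[OF H(1)]) auto
    thus ?thesis by (simp add: h_def[abs_def] o_def)
  qed
  have h_node: "h j (\<i> * of_nat m) = snd (N m) $ j" for j m
  proof -
    have "\<i> * of_nat m + \<i> = \<i> * of_nat (Suc m)" by (simp add: algebra_simps)
    thus ?thesis unfolding h_def by (simp only: H(2)) simp
  qed
  \<comment> \<open>The index is \<open>2 * Suc n - 1 = 2 * n + 1\<close>, the odd node that carries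
    \<open>\<beta> n\<close>.\<close>
  have h_band: "norm (h j z - snd (\<beta> n) $ j) \<le> \<epsilon>'" if "z + \<i> \<in> band (Suc n)" for j n z
    using H(3)[OF that, of j] by (simp add: h_def N_def)
  \<comment> \<open>Any index serves; \<open>undefined\<close> merely names one. All critical points
    of this single second component lie in \<open>W\<close>, where the first components will be
    noncritical.\<close>
  define j0 :: 'l where "j0 = undefined"
  define i0 :: 'k where "i0 = undefined"
  define W where "W = {z. deriv (h j0) z = 0}"
  have "h j0 (- \<i>) \<noteq> h j0 (\<i> * of_nat 0)"
    unfolding h_node using H(2)[of j0 0] by (simp add: h_def)
  hence "countable W" unfolding W_def by (intro countable_zeros_deriv h_hol)
  have "\<exists>g. g holomorphic_on UNIV \<and> (\<forall>m. g (\<i> * of_nat m) = fst (N m) $ i) \<and>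
      (\<forall>n z. z \<in> band n \<longrightarrow> norm (g z - fst (N (2 * n)) $ i) \<le> \<epsilon>) \<and> (\<forall>w\<in>W. deriv g w \<noteq> 0)" for i
    by (rule ex_band_interpolation_deriv_nonzero[OF \<epsilon>(1) \<open>countable W\<close>, of "\<lambda>m. fst (N m) $ i"]) blast
  then obtain g where g: "\<And>i. g i holomorphic_on UNIV"
    "\<And>i m. g i (\<i> * of_nat m) = fst (N m) $ i"
    "\<And>i n z. z \<in> band n \<Longrightarrow> norm (g i z - fst (N (2 * n)) $ i) \<le> \<epsilon>"
    "\<And>i w. w \<in> W \<Longrightarrow> deriv (g i) w \<noteq> 0"
    by metis
  define f where "f z = ((\<chi> i. g i z), (\<chi> j. h j z))" for z
  have immersive: "complex_derivative f z \<noteq> 0" for z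
  proof
    assume "complex_derivative f z = 0"
    hence "(\<chi> i. deriv (g i) z) = 0" "(\<chi> j. deriv (h j) z) = 0"
      by (simp_all add: complex_derivative_def f_def zero_prod_def)
    hence "deriv (g i0) z = 0" "deriv (h j0) z = 0" by (simp_all add: vec_eq_iff)
    thus False using g(4) by (auto simp: W_def)
  qed
  have hol: "holomorphic_map f"
    using g(1) h_hol by (simp add: holomorphic_map_def f_def)
  have f_node: "f (\<i> * of_nat m) = N m" for m
    by (simp add: f_def g(2) h_node)
  have surj: "C \<subseteq> range f"
  proof
    fix c assume "c \<in> C"
    then consider n where "c = \<alpha> n" | n where "c = \<beta> n"
      using \<open>C \<subseteq> CF \<union> CG\<close> \<alpha> \<beta> by blast
    thus "c \<in> range f"
    proof cases
      case (1 n)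
      hence "c = f (\<i> * of_nat (2 * n))" unfolding f_node by (simp add: N_def)
      thus ?thesis by blast
    next
      case (2 n)
      hence "c = f (\<i> * of_nat (2 * n + 1))" unfolding f_node by (simp add: N_def)
      thus ?thesis by blast
    qed
  qed
  have avoid: "f z \<notin> F \<times> G" for z
  proof (rule band_cover[of z])
    fix n assume z: "z \<in> band n"
    have "dist (\<chi> i. g i z) (fst (\<alpha> n)) < \<delta>"
      using g(3)[OF z] by (intro dist_vec_less[OF _ \<epsilon>(2)]) (simp add: N_def)
    hence "(\<chi> i. g i z) \<in> ball (fst (\<alpha> n)) \<delta>" by (simp add: dist_commute)
    moreover have "ball (fst (\<alpha> n)) \<delta> \<inter> F = {}" using \<alpha> by (auto simp: CF_def)
    ultimately show ?thesis unfolding f_def by blast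
  next
    fix n assume z: "z + \<i> \<in> band (Suc n)"
    have "dist (\<chi> j. h j z) (snd (\<beta> n)) < \<delta>"
      using h_band[OF z] by (intro dist_vec_less[OF _ \<epsilon>'(2)]) simp
    hence "(\<chi> j. h j z) \<in> ball (snd (\<beta> n)) \<delta>" by (simp add: dist_commute)
    moreover have "ball (snd (\<beta> n)) \<delta> \<inter> G = {}" using \<beta> by (auto simp: CG_def)
    ultimately show ?thesis unfolding f_def by blast
  qed
  have "range f \<subseteq> UNIV - F \<times> G" by (intro image_subsetI DiffI UNIV_I avoid)
  thus ?thesis
    unfolding holomorphic_immersion_def using immersive hol surj by (intro exI[of _ f]) simp
qed

end
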